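(* Let $m\le 1$ and $\mathcal{S}=\{m,m+1,\ldots,1\}$. Let $n(i,\mathbf{c})$ be non-negative integers for $i\in\mathbb{Z}$ and $\mathbf{c}=(c^m,\ldots,c^1)\in\mathbb{N}^{2-m}$. Define $n_i=\sum_{\mathbf{c}}n(i,\mathbf{c})$, let $\ell,r$ be the smallest and largest $i$ with $n_i>0$, assume $n_i>0$ for $\ell\le i\le r$, and assume the compatibility condition $\chi_{i=0}+\sum_{s\in\mathcal{S},\mathbf{c}}c^s\,n(i-s,\mathbf{c})=\sum_{\mathbf{c}}n(i,\mathbf{c})$ for $\ell\le i\le r$. Assume moreover that either $m=-1$, or $n(i,\mathbf{c})=0$ for all $i<0$ and all $\mathbf{c}$. Let $n=\sum_i n_i$, $n(i,s)=\sum_{\mathbf{c}}c^s\,n(i-s,\mathbf{c})$, and $n_s(b)=\sum_i\sum_{\mathbf{c}:c^s=b}n(i,\mathbf{c})$. Then the number of $\mathcal{S}$-embedded Cayley trees in which, for all $i$ and $\mathbf{c}$, exactly $n(i,\mathbf{c})$ vertices have in-type $(i;\mathbf{c})$ is $$\frac{n!\prod_{i=\ell}^r(n_i-1)!}{\prod_{i,\mathbf{c}}n(i,\mathbf{c})!\prod_{b\ge 0,\,s\in\mathcal{S}}b!^{\,n_s(b)}}\prod_{i=\ell}^{-1}n(i,-1)\prod_{i=1}^r n(i,1).$$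
   Context: An $\mathcal{S}$-embedded Cayley tree is a tree on vertex set $\{1,\ldots,n\}$ with a distinguished root, together with abscissas $a(v)\in\mathbb{Z}$ such that the root has abscissa $0$ and $a(v')-a(v)\in\mathcal{S}$ whenever $v'$ is a child of $v$. A vertex $v$ has in-type $(i;\mathbf{c})$, $\mathbf{c}=(c^m,\ldots,c^1)$, if $a(v)=i$ and for each $m\le k\le 1$, $v$ has exactly $c^k$ children at abscissa $i+k$. Thus $n(i,s)$ is the number of vertices at abscissa $i$ whose parent lies at abscissa $i-s$, and $n_s(b)$ is the number of vertices $v$ having exactly $b$ children at abscissa $a(v)+s$. $\chi_P$ is $1$ if $P$ holds and $0$ otherwise.
   Formalization: The compatibility condition is also required outside [ℓ,r]: n(i,s)=0 for i<ℓ or i>r and s∈S, i.e. no vertex has a child at an unoccupied abscissa. Without it the claim fails: m=1, n(0,(5))=1 gives 1/5! but there is no such tree. *)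

theory Defs
  imports Complex_Main "HOL-Library.FuncSet"
begin

text \<open>An undirected simple graph is given by a vertex set and a set of two-element edges.\<close>

definition is_path :: "'a set set \<Rightarrow> 'a list \<Rightarrow> bool" where
  "is_path E p \<longleftrightarrow> p \<noteq> [] \<and> distinct p \<and> successively (\<lambda>u v. {u, v} \<in> E) p"

definition is_cycle :: "'a set set \<Rightarrow> 'a list \<Rightarrow> bool" where
  "is_cycle E p \<longleftrightarrow> length p \<ge> 3 \<and> is_path E p \<and> {last p, hd p} \<in> E"

definition is_tree :: "'a set \<Rightarrow> 'a set set \<Rightarrow> bool" where
  "is_tree V E \<longleftrightarrow>
     V \<noteq> {} \<and> (\<forall>e\<in>E. e \<subseteq> V \<and> card e = 2) \<and>
     (\<forall>u\<in>V. \<forall>v\<in>V. \<exists>p. is_path E p \<and> hd p = u \<and> last p = v) \<and>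
     (\<nexists>p. is_cycle E p)"

text \<open>In the tree \<open>E\<close> rooted at \<open>\<rho>\<close>, the parent of \<open>w\<close> is the last vertex before \<open>w\<close> on the path
  from \<open>\<rho>\<close> to \<open>w\<close>.\<close>

definition is_child :: "'a set set \<Rightarrow> 'a \<Rightarrow> 'a \<Rightarrow> 'a \<Rightarrow> bool" where
  "is_child E \<rho> v w \<longleftrightarrow> (\<exists>q. is_path E (q @ [v, w]) \<and> hd (q @ [v, w]) = \<rho>)"

text \<open>A tree is a triple of edge set, root and abscissas; the abscissas are extensional outside the
  vertex set, so that different triples are different trees.\<close>

definition embedded_cayley_trees ::
    "int set \<Rightarrow> nat \<Rightarrow> (nat set set \<times> nat \<times> (nat \<Rightarrow> int)) set" where
  "embedded_cayley_trees S N =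
     {(E, \<rho>, a). is_tree {1..N} E \<and> \<rho> \<in> {1..N} \<and> a \<in> {1..N} \<rightarrow>\<^sub>E UNIV \<and>
        a \<rho> = 0 \<and> (\<forall>v w. is_child E \<rho> v w \<longrightarrow> a w - a v \<in> S)}"

text \<open>A vector \<open>c \<in> \<nat>\<^sup>S\<close> is an element of \<open>S \<rightarrow>\<^sub>E UNIV\<close>.\<close>

definition in_type ::
    "int set \<Rightarrow> 'a set set \<Rightarrow> 'a \<Rightarrow> ('a \<Rightarrow> int) \<Rightarrow> 'a \<Rightarrow> int \<times> (int \<Rightarrow> nat)" where
  "in_type S E \<rho> a v = (a v, \<lambda>k\<in>S. card {w. is_child E \<rho> v w \<and> a w = a v + k})"

text \<open>The following are \<open>n\<^sub>i\<close>, \<open>n\<close>, \<open>n(i,s)\<close> and \<open>n\<^sub>s(b)\<close> for a family \<open>n(i,c)\<close> of finite support.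
  The sums run over the support, as sums over infinite sets are \<open>0\<close> by convention.\<close>

definition level_count :: "(int \<Rightarrow> (int \<Rightarrow> nat) \<Rightarrow> nat) \<Rightarrow> int \<Rightarrow> nat" where
  "level_count n i = (\<Sum>c | n i c > 0. n i c)"

definition total_count :: "(int \<Rightarrow> (int \<Rightarrow> nat) \<Rightarrow> nat) \<Rightarrow> nat" where
  "total_count n = (\<Sum>i | level_count n i > 0. level_count n i)"

definition step_count :: "(int \<Rightarrow> (int \<Rightarrow> nat) \<Rightarrow> nat) \<Rightarrow> int \<Rightarrow> int \<Rightarrow> nat" where
  "step_count n i s = (\<Sum>c | n (i - s) c > 0. c s * n (i - s) c)"

definition children_count :: "(int \<Rightarrow> (int \<Rightarrow> nat) \<Rightarrow> nat) \<Rightarrow> int \<Rightarrow> nat \<Rightarrow> nat" where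
  "children_count n s b = (\<Sum>(i, c) | n i c > 0 \<and> c s = b. n i c)"

end

theory Submission
  imports Defs
begin

text \<open>
  First distribute the in-types over the labelled vertices; this gives the factor
  \<open>n! / \<Prod> n(i,c)!\<close>. It remains to count the acyclic parent functions for which every vertex \<open>u\<close> has a
  prescribed number of children at every level, the root being the child of a virtual vertex.
  The parents are assigned level by level, in order of decreasing \<open>|i|\<close>. When level \<open>i\<close> is treated, every
  candidate parent leads, through the edges already chosen, either back to level \<open>i\<close> or out of the levels
  treated so far. If \<open>k\<close> is the number of child slots of the second kind, there are
  \<open>(n\<^sub>i - 1)! k\<close> acyclic ways to fill the slots with the vertices of level \<open>i\<close>, up to the permutations of
  siblings. Since levels change by at most one towards the origin, \<open>k\<close> is \<open>n(i,1)\<close> for \<open>i > 0\<close>,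
  \<open>n(i,-1)\<close> for \<open>i < 0\<close>, and \<open>1\<close> for \<open>i = 0\<close>.
\<close>

section \<open>Functions with prescribed fibre sizes\<close>

definition fibre_funs :: "'a set \<Rightarrow> 'b set \<Rightarrow> ('b \<Rightarrow> nat) \<Rightarrow> ('a \<Rightarrow> 'b) set" where
  "fibre_funs B T c = {g \<in> B \<rightarrow>\<^sub>E T. \<forall>u\<in>T. card {b \<in> B. g b = u} = c u}"

lemma finite_fibre_funs: "finite B \<Longrightarrow> finite T \<Longrightarrow> finite (fibre_funs B T c)"
  unfolding fibre_funs_def by (rule finite_subset[of _ "B \<rightarrow>\<^sub>E T"]) (auto intro: finite_PiE)

lemma fibre_funs_pos:
  assumes "finite B" "g \<in> fibre_funs B T c" "b \<in> B"
  shows "g b \<in> T" "c (g b) > 0"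
proof -
  show T: "g b \<in> T" using assms by (auto simp: fibre_funs_def)
  have "card {b' \<in> B. g b' = g b} = c (g b)" using assms T by (auto simp: fibre_funs_def)
  moreover have "b \<in> {b' \<in> B. g b' = g b}" using assms by auto
  ultimately show "c (g b) > 0"
    by (metis (no_types, lifting) assms(1) card_gt_0_iff empty_iff finite_subset mem_Collect_eq subsetI)
qed

text \<open>Recursion on the domain: \<open>x\<close> takes any value \<open>u\<close> of positive
  multiplicity, and the rest realises the multiplicities with \<open>u\<close> lowered by one. The
  inverse resets \<open>x\<close> to \<open>undefined\<close> so that the remainder is
  extensional.\<close>

lemma fibre_funs_insert:
  assumes "finite B" "x \<notin> B"
  shows "bij_betw (\<lambda>(u, g). g(x := u))
           (SIGMA u:{u \<in> T. c u > 0}. fibre_funs B T (c(u := c u - 1))) (fibre_funs (insert x B) T c)"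
proof (rule bij_betw_byWitness[where f' = "\<lambda>g. (g x, g(x := undefined))"])
  have fib: "card {b \<in> insert x B. (g(x := u)) b = w} = card {b \<in> B. g b = w} + of_bool (w = u)" for g u w
  proof -
    have "{b \<in> insert x B. (g(x := u)) b = w} = (if w = u then insert x {b \<in> B. g b = w} else {b \<in> B. g b = w})"
      using assms by auto
    thus ?thesis using assms by simp
  qed
  show "(\<lambda>(u, g). g(x := u)) ` (SIGMA u:{u \<in> T. c u > 0}. fibre_funs B T (c(u := c u - 1)))
          \<subseteq> fibre_funs (insert x B) T c"
  proof safe
    fix u g assume u: "u \<in> T" "c u > 0" and g: "g \<in> fibre_funs B T (c(u := c u - 1))"
    have "g(x := u) \<in> insert x B \<rightarrow>\<^sub>E T" using g u unfolding fibre_funs_def by (intro PiE_fun_upd) auto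
    moreover have "card {b \<in> insert x B. (g(x := u)) b = w} = c w" if "w \<in> T" for w
      unfolding fib using g u that by (auto simp: fibre_funs_def)
    ultimately show "g(x := u) \<in> fibre_funs (insert x B) T c" unfolding fibre_funs_def by blast
  qed
  show "(\<lambda>g. (g x, g(x := undefined))) ` fibre_funs (insert x B) T c
          \<subseteq> (SIGMA u:{u \<in> T. c u > 0}. fibre_funs B T (c(u := c u - 1)))"
  proof safe
    fix g assume g: "g \<in> fibre_funs (insert x B) T c"
    have *: "g x \<in> T" "c (g x) > 0" using fibre_funs_pos[OF _ g, of x] assms by auto
    thus "g x \<in> T" "c (g x) > 0" by auto
    have "g(x := undefined) \<in> B \<rightarrow>\<^sub>E T" using g assms by (auto simp: fibre_funs_def PiE_iff extensional_def)
    moreover have "card {b \<in> B. (g(x := undefined)) b = w} = (c(g x := c (g x) - 1)) w" if "w \<in> T" for w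
    proof -
      have "card {b \<in> insert x B. g b = w} = c w" using g that by (auto simp: fibre_funs_def)
      moreover have "((g(x := undefined))(x := g x)) = g" by auto
      ultimately show ?thesis using fib[of "g(x := undefined)" "g x" w] by auto
    qed
    ultimately show "g(x := undefined) \<in> fibre_funs B T (c(g x := c (g x) - 1))"
      by (auto simp: fibre_funs_def)
  qed
qed (use assms in \<open>auto simp: fibre_funs_def PiE_iff extensional_def\<close>)

text \<open>The predicate \<open>P\<close> is carried along so that one recursion serves both the
  unrestricted and the acyclic count.\<close>

lemma card_fibre_funs_insert:
  assumes "finite B" "x \<notin> B" "finite T"
  shows "card {g \<in> fibre_funs (insert x B) T c. P g} =
         (\<Sum>u | u \<in> T \<and> c u > 0. card {g \<in> fibre_funs B T (c(u := c u - 1)). P (g(x := u))})"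
proof -
  let ?S = "SIGMA u:{u \<in> T. c u > 0}. fibre_funs B T (c(u := c u - 1))"
  let ?S' = "SIGMA u:{u \<in> T. c u > 0}. {g \<in> fibre_funs B T (c(u := c u - 1)). P (g(x := u))}"
  have bij: "bij_betw (\<lambda>(u, g). g(x := u)) ?S (fibre_funs (insert x B) T c)"
    by (rule fibre_funs_insert[OF assms(1,2)])
  have "bij_betw (\<lambda>(u, g). g(x := u)) ?S' {g \<in> fibre_funs (insert x B) T c. P g}"
  proof (rule bij_betw_subset[OF bij])
    show "?S' \<subseteq> ?S" by auto
    have "fibre_funs (insert x B) T c = (\<lambda>(u, g). g(x := u)) ` ?S"
      using bij by (simp add: bij_betw_def)
    thus "(\<lambda>(u, g). g(x := u)) ` ?S' = {g \<in> fibre_funs (insert x B) T c. P g}" by fastforce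
  qed
  hence "card {g \<in> fibre_funs (insert x B) T c. P g} = card ?S'" by (simp add: bij_betw_same_card)
  also have "\<dots> = (\<Sum>u | u \<in> T \<and> c u > 0. card {g \<in> fibre_funs B T (c(u := c u - 1)). P (g(x := u))})"
    using assms by (subst card_SigmaI) (auto simp: finite_fibre_funs)
  finally show ?thesis .
qed

lemma prod_fact_decrement:
  assumes "finite T" "u \<in> T" "c u > 0"
  shows "(\<Prod>w\<in>T. fact (c w)) = c u * (\<Prod>w\<in>T. fact ((c(u := c u - 1)) w) :: nat)"
proof -
  have "(\<Prod>w\<in>T - {u}. fact ((c(u := c u - 1)) w)) = (\<Prod>w\<in>T - {u}. fact (c w) :: nat)"
    by (rule prod.cong) auto
  moreover have "fact (c u) = c u * (fact (c u - 1) :: nat)" using assms(3) by (simp add: fact_reduce)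
  ultimately show ?thesis using assms by (simp add: prod.remove[of T u])
qed

lemma sum_decrement:
  assumes "finite T" "u \<in> T" "c u > 0"
  shows "sum (c(u := c u - 1)) T + 1 = (sum c T :: nat)"
proof -
  have "sum (c(u := c u - 1)) (T - {u}) = sum c (T - {u})" by (rule sum.cong) auto
  thus ?thesis using assms by (simp add: sum.remove[of T u])
qed

text \<open>The multinomial coefficient, multiplied out to stay in the naturals. Deleting a point
  with image \<open>u\<close> splits a factor \<open>c u\<close> off the factorials, and these
  weights sum to the size of the domain.\<close>

lemma card_fibre_funs:
  assumes "finite B" "finite T" "sum c T = card B"
  shows "card (fibre_funs B T c) * (\<Prod>u\<in>T. fact (c u)) = fact (card B)"
  using assms
proof (induction B arbitrary: c rule: finite_induct)
  case empty
  hence z: "\<forall>u\<in>T. c u = 0" by auto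
  hence "fibre_funs {} T c = {\<lambda>_. undefined}" by (auto simp: fibre_funs_def)
  hence "card (fibre_funs {} T c) = 1" by (metis is_singletonI is_singleton_altdef)
  thus ?case using z by simp
next
  case (insert x B)
  let ?c = "\<lambda>u. c(u := c u - 1)"
  have "card (fibre_funs (insert x B) T c) = (\<Sum>u | u \<in> T \<and> c u > 0. card (fibre_funs B T (?c u)))"
    using card_fibre_funs_insert[of B x T c "\<lambda>_. True"] insert by simp
  hence "card (fibre_funs (insert x B) T c) * (\<Prod>u\<in>T. fact (c u)) =
     (\<Sum>u | u \<in> T \<and> c u > 0. card (fibre_funs B T (?c u)) * (\<Prod>u\<in>T. fact (c u)))"
    by (simp add: sum_distrib_right)
  also have "\<dots> = (\<Sum>u | u \<in> T \<and> c u > 0. c u * fact (card B))"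
  proof (rule sum.cong)
    fix u assume "u \<in> {u. u \<in> T \<and> c u > 0}"
    hence u: "u \<in> T" "c u > 0" by auto
    have "sum (?c u) T = card B" using sum_decrement[of T u c, OF \<open>finite T\<close> u] insert by simp
    from insert.IH[OF \<open>finite T\<close> this] show "card (fibre_funs B T (?c u)) * (\<Prod>u\<in>T. fact (c u)) = c u * fact (card B)"
      using prod_fact_decrement[of T u c, OF \<open>finite T\<close> u] by (simp add: mult_ac del: fun_upd_apply)
  qed simp
  also have "\<dots> = (\<Sum>u | u \<in> T \<and> c u > 0. c u) * fact (card B)" by (simp add: sum_distrib_right)
  also have "(\<Sum>u | u \<in> T \<and> c u > 0. c u) = sum c T"
    using insert by (intro sum.mono_neutral_left) auto
  also have "\<dots> * fact (card B) = fact (card (insert x B))" using insert by simp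
  finally show ?case .
qed

section \<open>Function graphs as relations, and acyclic functions with prescribed fibre
  sizes\<close>

definition fgraph :: "('a \<Rightarrow> 'b) \<Rightarrow> 'a set \<Rightarrow> ('a \<times> 'b) set" where
  "fgraph f A = (\<lambda>v. (v, f v)) ` A"

lemma fgraph_iff [simp]: "(v, w) \<in> fgraph f A \<longleftrightarrow> v \<in> A \<and> w = f v"
  by (auto simp: fgraph_def)

lemma fgraph_empty [simp]: "fgraph f {} = {}" by (simp add: fgraph_def)

lemma finite_fgraph [simp]: "finite A \<Longrightarrow> finite (fgraph f A)" by (simp add: fgraph_def)

lemma single_valued_fgraph: "single_valued (fgraph f A)"
  by (auto simp: single_valued_def)

lemma Domain_fgraph [simp]: "Domain (fgraph f A) = A" by (auto simp: fgraph_def)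

text \<open>The converse of a finite acyclic relation is well-founded, so some vertex of
  \<open>B\<close> has no path back to \<open>B\<close>.\<close>

lemma acyclic_finite_maximal:
  assumes "finite R" "acyclic R" "B \<noteq> {}"
  obtains z where "z \<in> B" "\<And>y. (z, y) \<in> R\<^sup>+ \<Longrightarrow> y \<notin> B"
proof -
  have "wf ((R\<inverse>)\<^sup>+)" using assms finite_acyclic_wf_converse wf_trancl by blast
  then obtain z where "z \<in> B" "\<And>y. (y, z) \<in> (R\<inverse>)\<^sup>+ \<Longrightarrow> y \<notin> B"
    using assms(3) by (metis wfE_min all_not_in_conv)
  thus ?thesis using that by (simp add: trancl_converse)
qed

text \<open>Cut the path after its last edge in \<open>G\<close>, if there is one: what remains uses
  only \<open>r\<close> and starts in \<open>U\<close>.\<close>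

lemma rtrancl_Un_entry:
  assumes "(y, z) \<in> (r \<union> G)\<^sup>*" "y \<in> U" "\<And>p q. (p, q) \<in> G \<Longrightarrow> q \<in> U"
  shows "\<exists>y'\<in>U. (y', z) \<in> r\<^sup>*"
  using assms(1) by (induction rule: rtrancl_induct) (use assms in \<open>auto intro: rtrancl_into_rtrancl\<close>)

text \<open>Pigeonhole. As \<open>r\<close> is single-valued and stops at \<open>B\<close>, a target
  leads to at most one point of \<open>B\<close>. If all points were reached, they would need
  \<open>card B\<close> distinct targets of positive multiplicity other than \<open>u0\<close>, and
  adding \<open>u0\<close> would exceed the total \<open>card B\<close>.\<close>

lemma exists_unreached:
  assumes "finite B" "finite T" "single_valued r" "Domain r \<inter> B = {}" "sum c T = card B"
    and "u0 \<in> T" "c u0 > 0" "\<forall>b\<in>B. (u0, b) \<notin> r\<^sup>*"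
  obtains x where "x \<in> B" "\<And>u. u \<in> T \<Longrightarrow> c u > 0 \<Longrightarrow> (u, x) \<notin> r\<^sup>*"
proof -
  have False if reached: "\<forall>x\<in>B. \<exists>u. u \<in> T \<and> c u > 0 \<and> (u, x) \<in> r\<^sup>*"
  proof -
    obtain h where h: "\<And>x. x \<in> B \<Longrightarrow> h x \<in> T \<and> c (h x) > 0 \<and> (h x, x) \<in> r\<^sup>*"
      using bchoice[OF reached] by blast
    have "inj_on h B"
    proof
      fix x y assume xy: "x \<in> B" "y \<in> B" "h x = h y"
      hence "(x, y) \<in> r\<^sup>* \<or> (y, x) \<in> r\<^sup>*" using single_valued_confluent[OF assms(3)] h by metis
      thus "x = y" using xy assms(4) by (metis DomainI converse_rtranclE disjoint_iff)
    qed
    hence "card B = card (h ` B)" by (simp add: card_image)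
    also have "\<dots> \<le> sum c (h ` B)" using h by (intro card_eq_sum[THEN ord_eq_le_trans] sum_mono) (auto simp: Suc_le_eq)
    also have "\<dots> < c u0 + sum c (h ` B)" using assms by simp
    also have "\<dots> = sum c (insert u0 (h ` B))" using assms h by (subst sum.insert) auto
    also have "\<dots> \<le> sum c T" using h assms by (intro sum_mono2) auto
    finally show False using assms by simp
  qed
  thus ?thesis using that by blast
qed

text \<open>Induction on \<open>B\<close>: a vertex \<open>x \<in> B\<close> that no target of positive multiplicity leads to is a leaf, so
  its image \<open>u\<close> is arbitrary and \<open>x\<close> can be deleted. Summing over \<open>u\<close> with weight \<open>c u\<close> gives
  \<open>(|B| - 2)! (|B| k - k)\<close>, where \<open>k\<close> is the total multiplicity of the targets that do not lead back to \<open>B\<close>.\<close>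

lemma card_acyclic_fibre_funs:
  assumes "finite B" "B \<noteq> {}" "finite T" "finite r" "single_valued r" "acyclic r" "Domain r \<inter> B = {}"
    and "sum c T = card B"
  shows "card {g \<in> fibre_funs B T c. acyclic (r \<union> fgraph g B)} * (\<Prod>u\<in>T. fact (c u)) =
         fact (card B - 1) * (\<Sum>u | u \<in> T \<and> (\<forall>b\<in>B. (u, b) \<notin> r\<^sup>*). c u)"
  using assms
proof (induction "card B" arbitrary: B c)
  case 0
  thus ?case by simp
next
  case (Suc N)
  note fin = \<open>finite B\<close> \<open>finite T\<close> \<open>finite r\<close>
  define k where "k = (\<Sum>u | u \<in> T \<and> (\<forall>b\<in>B. (u, b) \<notin> r\<^sup>*). c u)"
  let ?A = "{g \<in> fibre_funs B T c. acyclic (r \<union> fgraph g B)}"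
  show ?case
  proof (cases "k = 0")
    case True
    \<comment> \<open>With \<open>k = 0\<close> every target of positive multiplicity leads back to
      \<open>B\<close>. A point \<open>z\<close> of \<open>B\<close> from which \<open>B\<close>
      cannot be reached again is then impossible, because its image leads to \<open>B\<close>
      through \<open>r\<close>.\<close>
    have "?A = {}"
    proof (safe)
      fix g assume g: "g \<in> fibre_funs B T c" "acyclic (r \<union> fgraph g B)"
      obtain z where z: "z \<in> B" "\<And>y. (z, y) \<in> (r \<union> fgraph g B)\<^sup>+ \<Longrightarrow> y \<notin> B"
        using acyclic_finite_maximal[of "r \<union> fgraph g B" B] g fin \<open>B \<noteq> {}\<close> by auto
      have gz: "g z \<in> T" "c (g z) > 0" using fibre_funs_pos fin g z by metis+
      then obtain b where b: "b \<in> B" "(g z, b) \<in> r\<^sup>*" using True fin unfolding k_def by fastforce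
      have "(z, g z) \<in> r \<union> fgraph g B" using z by simp
      moreover have "(g z, b) \<in> (r \<union> fgraph g B)\<^sup>*" using b by (meson Un_upper1 rtrancl_mono subsetD)
      ultimately have "(z, b) \<in> (r \<union> fgraph g B)\<^sup>+" by (rule rtrancl_into_trancl2)
      thus "g \<in> {}" using z b by auto
    qed
    hence "card ?A = 0" by (simp only: card.empty)
    thus ?thesis using True unfolding k_def by (simp only: mult_0 mult_0_right)
  next
    case False
    \<comment> \<open>A target not leading to \<open>B\<close> is the surplus that the pigeonhole
      argument needs.\<close>
    then obtain u0 where u0: "u0 \<in> T" "c u0 > 0" "\<forall>b\<in>B. (u0, b) \<notin> r\<^sup>*"
      unfolding k_def by (rule sum.not_neutral_contains_not_neutral) auto
    obtain x where x: "x \<in> B" "\<And>u. u \<in> T \<Longrightarrow> c u > 0 \<Longrightarrow> (u, x) \<notin> r\<^sup>*"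
      using exists_unreached[of B T r c u0] Suc.prems u0 by metis
    define B' where "B' = B - {x}"
    have B: "B = insert x B'" "x \<notin> B'" "finite B'" "card B' = N"
      using x fin Suc(2) unfolding B'_def by auto
    let ?c = "\<lambda>u. c(u := c u - 1)"
    define A' where "A' u = card {g \<in> fibre_funs B' T (?c u). acyclic (r \<union> fgraph g B')}" for u
    have "card ?A = (\<Sum>u | u \<in> T \<and> c u > 0.
        card {g \<in> fibre_funs B' T (?c u). acyclic (r \<union> fgraph (g(x := u)) B)})"
      unfolding B(1) by (rule card_fibre_funs_insert) (use B fin in auto)
    also have "\<dots> = (\<Sum>u | u \<in> T \<and> c u > 0. A' u)"
      unfolding A'_def
    proof (intro sum.cong refl arg_cong[where f = card] Collect_cong conj_cong)
      fix u g assume "u \<in> {u. u \<in> T \<and> c u > 0}" and g: "g \<in> fibre_funs B' T (?c u)"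
      hence u: "u \<in> T" "c u > 0" by auto
      have eq: "r \<union> fgraph (g(x := u)) B = insert (x, u) (r \<union> fgraph g B')"
        using B unfolding fgraph_def by (auto intro!: image_eqI)
      \<comment> \<open>After its last edge from \<open>g\<close>, such a path would run inside
        \<open>r\<close> from a target of positive multiplicity to \<open>x\<close>, contrary to the
        choice of \<open>x\<close>. So the new edge from \<open>x\<close> to \<open>u\<close> closes
        no cycle.\<close>
      have "(u, x) \<notin> (r \<union> fgraph g B')\<^sup>*"
      proof
        assume "(u, x) \<in> (r \<union> fgraph g B')\<^sup>*"
        moreover have "q \<in> {u \<in> T. c u > 0}" if "(p, q) \<in> fgraph g B'" for p q
          using fibre_funs_pos[OF B(3) g, of p] that by (auto split: if_splits)
        ultimately have "\<exists>y'\<in>{u \<in> T. c u > 0}. (y', x) \<in> r\<^sup>*" using u by (intro rtrancl_Un_entry) auto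
        thus False using x by auto
      qed
      thus "acyclic (r \<union> fgraph (g(x := u)) B) = acyclic (r \<union> fgraph g B')"
        unfolding eq by (simp add: acyclic_insert)
    qed
    finally have rec: "card ?A = (\<Sum>u | u \<in> T \<and> c u > 0. A' u)" .
    \<comment> \<open>A singleton \<open>B\<close> is separate: the induction hypothesis wants a
      nonempty set, and \<open>N * fact (N - 1) = fact N\<close> fails for
      \<open>N = 0\<close>.\<close>
    show ?thesis
    proof (cases "B' = {}")
      case True
      hence cB: "card B = 1" using B by simp
      then obtain u where u: "u \<in> T" "c u = 1" "\<forall>b\<in>T. u \<noteq> b \<longrightarrow> c b = 0"
        using Suc.prems(8) sum_eq_1_iff[OF fin(2), of c] by auto
      hence U: "{u \<in> T. c u > 0} = {u}" by auto
      have "u0 = u" using u u0 by auto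
      have "k \<le> 1" unfolding k_def cB[symmetric] Suc.prems(8)[symmetric] using fin by (intro sum_mono2) auto
      hence "k = 1" using False by simp
      have "fibre_funs B' T (?c u) = {\<lambda>_. undefined}" using True u by (auto simp: fibre_funs_def)
      hence "A' u = 1" using True \<open>acyclic r\<close> by (simp add: A'_def conj_commute)
      moreover have "(\<Prod>u\<in>T. fact (c u)) = (1 :: nat)"
      proof (rule prod.neutral, safe)
        fix w assume "w \<in> T" thus "fact (c w) = (1 :: nat)" using u by (cases "w = u") auto
      qed
      ultimately show ?thesis using \<open>k = 1\<close> rec U cB by (simp add: k_def)
    next
      case B'ne: False
      let ?fr = "\<lambda>u. \<forall>b\<in>B. (u, b) \<notin> r\<^sup>*"
      \<comment> \<open>Using up one slot of \<open>u\<close> lowers \<open>k\<close> by one exactly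
        when \<open>u\<close> does not lead to \<open>B\<close>. The correction stands on the left
        to avoid subtraction of naturals.\<close>
      have step: "A' u * (\<Prod>u\<in>T. fact (c u)) + c u * of_bool (?fr u) * fact (N - 1) = c u * k * fact (N - 1)"
        if "u \<in> {u. u \<in> T \<and> c u > 0}" for u
      proof -
        have u: "u \<in> T" "c u > 0" using that by auto
        have "sum (?c u) T = card B'" using sum_decrement[of T u c, OF fin(2) u] B(4) Suc.prems(8) Suc(2)[symmetric] by (simp del: fun_upd_apply)
        hence "A' u * (\<Prod>w\<in>T. fact (?c u w)) =
            fact (card B' - 1) * (\<Sum>w | w \<in> T \<and> (\<forall>b\<in>B'. (w, b) \<notin> r\<^sup>*). ?c u w)"
          unfolding A'_def using Suc.prems B(3,4) B'ne unfolding B'_def by (intro Suc.hyps(1)) auto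
        \<comment> \<open>Replacing \<open>B'\<close> by \<open>B\<close> only drops targets that
          lead to \<open>x\<close>, and these have multiplicity 0.\<close>
        also have "(\<Sum>w | w \<in> T \<and> (\<forall>b\<in>B'. (w, b) \<notin> r\<^sup>*). ?c u w) = (\<Sum>w | w \<in> T \<and> ?fr w. ?c u w)"
          using fin x unfolding B'_def by (intro sum.mono_neutral_right) (auto split: if_splits)
        finally have 1: "A' u * (\<Prod>w\<in>T. fact (?c u w)) = fact (N - 1) * (\<Sum>w | w \<in> T \<and> ?fr w. ?c u w)"
          using B(4) by simp
        have 2: "(\<Sum>w | w \<in> T \<and> ?fr w. ?c u w) + of_bool (?fr u) = k"
        proof (cases "?fr u")
          case True
          thus ?thesis unfolding k_def using sum_decrement[of "{w \<in> T. ?fr w}" u c] u fin by simp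
        next
          case False
          thus ?thesis unfolding k_def by (auto intro!: sum.cong)
        qed
        have "A' u * (\<Prod>u\<in>T. fact (c u)) = c u * (A' u * (\<Prod>w\<in>T. fact (?c u w)))"
          using prod_fact_decrement[of T u c, OF fin(2) u] by (simp add: mult_ac del: fun_upd_apply)
        also have "\<dots> = c u * fact (N - 1) * (\<Sum>w | w \<in> T \<and> ?fr w. ?c u w)" unfolding 1 by simp
        finally show ?thesis unfolding 2[symmetric] by (simp add: algebra_simps)
      qed
      \<comment> \<open>The corrections sum to \<open>k * fact (N - 1)\<close> and the right-hand
        sides to \<open>Suc N * k * fact (N - 1)\<close>; the difference is
        \<open>N * fact (N - 1) * k\<close>.\<close>
      have "card ?A * (\<Prod>u\<in>T. fact (c u)) + k * fact (N - 1)
          = (\<Sum>u | u \<in> T \<and> c u > 0. A' u * (\<Prod>u\<in>T. fact (c u)) + c u * of_bool (?fr u) * fact (N - 1))"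
      proof -
        have "k = (\<Sum>u | u \<in> T \<and> c u > 0. c u * of_bool (?fr u))"
          unfolding k_def using fin by (intro sum.mono_neutral_cong) auto
        thus ?thesis unfolding rec by (simp add: sum.distrib sum_distrib_right)
      qed
      also have "\<dots> = (\<Sum>u | u \<in> T \<and> c u > 0. c u * k * fact (N - 1))"
        by (rule sum.cong[OF refl step])
      also have "\<dots> = (\<Sum>u | u \<in> T \<and> c u > 0. c u) * (k * fact (N - 1))"
        by (simp only: sum_distrib_right mult.assoc)
      also have "(\<Sum>u | u \<in> T \<and> c u > 0. c u) = sum c T"
        using fin by (intro sum.mono_neutral_left) auto
      also have "sum c T = Suc N" using Suc.prems(8) Suc(2) by simp
      finally have "card ?A * (\<Prod>u\<in>T. fact (c u)) = N * fact (N - 1) * k" by simp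
      also have "N * fact (N - 1) = (fact N :: nat)"
        using B'ne B(3,4) by (cases N) auto
      finally show ?thesis using Suc(2)[symmetric] by (simp add: k_def)
    qed
  qed
qed

section \<open>Assigning parents level by level\<close>

definition level :: "'a set \<Rightarrow> ('a \<Rightarrow> int) \<Rightarrow> int \<Rightarrow> 'a set" where
  "level V a i = {v \<in> V. a v = i}"

text \<open>The root of a tree is sent to a virtual vertex \<open>z\<close> outside \<open>V\<close>. Only the vertices at levels
  in \<open>J\<close> have been given a parent so far.\<close>

definition partial_trees ::
    "'a set \<Rightarrow> 'a \<Rightarrow> ('a \<Rightarrow> int) \<Rightarrow> (int \<Rightarrow> 'a \<Rightarrow> nat) \<Rightarrow> int set \<Rightarrow> ('a \<Rightarrow> 'a) set" where
  "partial_trees V z a d J = {f \<in> {v \<in> V. a v \<in> J} \<rightarrow>\<^sub>E insert z V.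
     (\<forall>i\<in>J. \<forall>u\<in>insert z V. card {v \<in> level V a i. f v = u} = d i u) \<and>
     acyclic (fgraph f {v \<in> V. a v \<in> J})}"

lemma finite_partial_trees: "finite V \<Longrightarrow> finite (partial_trees V z a d J)"
  unfolding partial_trees_def
  by (rule finite_subset[of _ "{v \<in> V. a v \<in> J} \<rightarrow>\<^sub>E insert z V"]) (auto intro: finite_PiE)

lemma partial_trees_pos:
  assumes "finite V" "f \<in> partial_trees V z a d J" "v \<in> V" "a v \<in> J"
  shows "f v \<in> insert z V" "d (a v) (f v) > 0"
proof -
  show T: "f v \<in> insert z V" using assms by (auto simp: partial_trees_def PiE_iff)
  have "card {w \<in> level V a (a v). f w = f v} = d (a v) (f v)"
    using assms T by (auto simp: partial_trees_def)
  moreover have "v \<in> {w \<in> level V a (a v). f w = f v}" using assms by (auto simp: level_def)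
  moreover have "finite {w \<in> level V a (a v). f w = f v}" using assms by (auto simp: level_def)
  ultimately show "d (a v) (f v) > 0" by (metis card_gt_0_iff empty_iff)
qed

lemma fgraph_cong: "(\<And>v. v \<in> A \<Longrightarrow> f v = g v) \<Longrightarrow> fgraph f A = fgraph g A"
  by (auto simp: fgraph_def)

lemma fgraph_Un: "fgraph f (A \<union> B) = fgraph f A \<union> fgraph f B"
  by (auto simp: fgraph_def)

text \<open>Fibre sizes are prescribed separately for each level, so the parents of the new level
  are coupled to the earlier choices by acyclicity alone.\<close>

lemma partial_trees_insert:
  assumes "i \<notin> J"
  shows "bij_betw (\<lambda>(f, g). override_on f g (level V a i))
    (SIGMA f:partial_trees V z a d J.
       {g \<in> fibre_funs (level V a i) (insert z V) (d i).
          acyclic (fgraph f {v \<in> V. a v \<in> J} \<union> fgraph g (level V a i))})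
    (partial_trees V z a d (insert i J))"
proof -
  let ?B = "level V a i" and ?D = "{v \<in> V. a v \<in> J}"
  have D: "{v \<in> V. a v \<in> insert i J} = ?D \<union> ?B" by (auto simp: level_def)
  have disj: "?B \<inter> ?D = {}" using assms by (auto simp: level_def)
  have disj': "level V a j \<inter> ?B = {}" if "j \<in> J" for j using assms that by (auto simp: level_def)
  show ?thesis
  proof (rule bij_betw_byWitness[where f' = "\<lambda>h. (restrict h ?D, restrict h ?B)"])
    show "\<forall>p\<in>(SIGMA f:partial_trees V z a d J.
       {g \<in> fibre_funs ?B (insert z V) (d i). acyclic (fgraph f ?D \<union> fgraph g ?B)}).
      (\<lambda>h. (restrict h ?D, restrict h ?B)) ((\<lambda>(f, g). override_on f g ?B) p) = p"
      using disj by (auto simp: partial_trees_def fibre_funs_def PiE_iff extensional_def override_on_def fun_eq_iff)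
    show "\<forall>h\<in>partial_trees V z a d (insert i J).
      (\<lambda>(f, g). override_on f g ?B) (restrict h ?D, restrict h ?B) = h"
    proof
      fix h assume "h \<in> partial_trees V z a d (insert i J)"
      hence "h \<in> extensional (?D \<union> ?B)" unfolding partial_trees_def D PiE_iff by blast
      thus "(\<lambda>(f, g). override_on f g ?B) (restrict h ?D, restrict h ?B) = h"
        by (auto simp: extensional_def override_on_def fun_eq_iff)
    qed
    show "(\<lambda>(f, g). override_on f g ?B) ` (SIGMA f:partial_trees V z a d J.
       {g \<in> fibre_funs ?B (insert z V) (d i). acyclic (fgraph f ?D \<union> fgraph g ?B)})
       \<subseteq> partial_trees V z a d (insert i J)"
    proof safe
      fix f g assume f: "f \<in> partial_trees V z a d J" and g: "g \<in> fibre_funs ?B (insert z V) (d i)"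
        and ac: "acyclic (fgraph f ?D \<union> fgraph g ?B)"
      let ?h = "override_on f g ?B"
      have "?h \<in> ?D \<union> ?B \<rightarrow>\<^sub>E insert z V"
        using f g by (auto simp: partial_trees_def fibre_funs_def PiE_iff extensional_def override_on_def)
      moreover have "card {v \<in> level V a j. ?h v = u} = d j u" if "j \<in> insert i J" "u \<in> insert z V" for j u
      proof (cases "j = i")
        case True
        hence "{v \<in> level V a j. ?h v = u} = {v \<in> ?B. g v = u}" by (auto simp: override_on_def)
        thus ?thesis using g that True by (auto simp: fibre_funs_def)
      next
        case False
        hence "{v \<in> level V a j. ?h v = u} = {v \<in> level V a j. f v = u}"
          using disj'[of j] that by (auto simp: override_on_def)
        thus ?thesis using f that False by (auto simp: partial_trees_def)
      qed
      moreover have "fgraph ?h (?D \<union> ?B) = fgraph f ?D \<union> fgraph g ?B"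
        unfolding fgraph_Un using disj by (intro arg_cong2[where f = "(\<union>)"] fgraph_cong) (auto simp: override_on_def)
      ultimately show "?h \<in> partial_trees V z a d (insert i J)"
        unfolding partial_trees_def D using ac by auto
    qed
    show "(\<lambda>h. (restrict h ?D, restrict h ?B)) ` partial_trees V z a d (insert i J)
       \<subseteq> (SIGMA f:partial_trees V z a d J.
       {g \<in> fibre_funs ?B (insert z V) (d i). acyclic (fgraph f ?D \<union> fgraph g ?B)})"
    proof (rule image_subsetI)
      fix h assume "h \<in> partial_trees V z a d (insert i J)"
      hence h: "h \<in> ?D \<union> ?B \<rightarrow>\<^sub>E insert z V"
        "\<And>j u. j \<in> insert i J \<Longrightarrow> u \<in> insert z V \<Longrightarrow> card {v \<in> level V a j. h v = u} = d j u"
        "acyclic (fgraph h (?D \<union> ?B))"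
        unfolding partial_trees_def D by auto
      have gr: "fgraph (restrict h ?D) ?D = fgraph h ?D" "fgraph (restrict h ?B) ?B = fgraph h ?B"
        by (auto intro!: fgraph_cong)
      have ac: "acyclic (fgraph (restrict h ?D) ?D \<union> fgraph (restrict h ?B) ?B)"
        using h(3) unfolding gr fgraph_Un .
      have "restrict h ?D \<in> partial_trees V z a d J"
        unfolding partial_trees_def
      proof (intro CollectI conjI ballI)
        show "restrict h ?D \<in> ?D \<rightarrow>\<^sub>E insert z V" using h(1) by auto
        show "acyclic (fgraph (restrict h ?D) ?D)" using ac by (rule acyclic_subset) auto
        fix j u assume ju: "j \<in> J" "u \<in> insert z V"
        have "{v \<in> level V a j. restrict h ?D v = u} = {v \<in> level V a j. h v = u}"
          using ju by (auto simp: level_def)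
        thus "card {v \<in> level V a j. restrict h ?D v = u} = d j u" using h(2) ju by auto
      qed
      moreover have "restrict h ?B \<in> fibre_funs ?B (insert z V) (d i)"
        unfolding fibre_funs_def
      proof (intro CollectI conjI ballI)
        show "restrict h ?B \<in> ?B \<rightarrow>\<^sub>E insert z V" using h(1) by auto
        fix u assume u: "u \<in> insert z V"
        have "{v \<in> ?B. restrict h ?B v = u} = {v \<in> ?B. h v = u}" by auto
        thus "card {v \<in> ?B. restrict h ?B v = u} = d i u" using h(2) u by auto
      qed
      ultimately show "(restrict h ?D, restrict h ?B) \<in> (SIGMA f:partial_trees V z a d J.
       {g \<in> fibre_funs ?B (insert z V) (d i). acyclic (fgraph f ?D \<union> fgraph g ?B)})"
        using ac by blast
    qed
  qed
qed

text \<open>Following the edges must stop in a finite acyclic graph, and only vertices outside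
  \<open>D\<close> have no outgoing edge.\<close>

lemma fgraph_reaches_exit:
  assumes "finite D" "acyclic (fgraph f D)"
  obtains w where "(u, w) \<in> (fgraph f D)\<^sup>*" "w \<notin> D"
proof -
  obtain w where w: "(u, w) \<in> (fgraph f D)\<^sup>*"
    "\<And>y. (w, y) \<in> (fgraph f D)\<^sup>+ \<Longrightarrow> (u, y) \<notin> (fgraph f D)\<^sup>*"
    using acyclic_finite_maximal[of "fgraph f D" "{w. (u, w) \<in> (fgraph f D)\<^sup>*}"] assms by auto
  have "w \<notin> D"
  proof
    assume "w \<in> D"
    hence "(w, f w) \<in> fgraph f D" by simp
    thus False using w by (meson r_into_trancl' rtrancl.rtrancl_into_rtrancl)
  qed
  thus ?thesis using w that by blast
qed

text \<open>Here \<open>d i u\<close> is the number of children at level \<open>i\<close> required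
  of \<open>u\<close>, and \<open>z\<close> is the virtual parent of the root. \<open>d_pos\<close>
  and \<open>d_neg\<close> say that passing to a parent in \<open>V\<close> moves at most one level
  towards the origin from a nonzero level; moves away from it are unrestricted.\<close>

locale level_system =
  fixes V :: "'a set" and z :: 'a and a :: "'a \<Rightarrow> int" and d :: "int \<Rightarrow> 'a \<Rightarrow> nat" and L :: "int set"
  assumes fin: "finite V" and z: "z \<notin> V" and L: "a ` V = L"
    and d_sum: "\<And>i. i \<in> L \<Longrightarrow> sum (d i) (insert z V) = card (level V a i)"
    and d_root: "\<And>i. d i z = of_bool (i = 0)"
    and d_pos: "\<And>i u. i \<in> L \<Longrightarrow> i > 0 \<Longrightarrow> u \<in> V \<Longrightarrow> d i u > 0 \<Longrightarrow> i - 1 \<le> a u"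
    and d_neg: "\<And>i u. i \<in> L \<Longrightarrow> i < 0 \<Longrightarrow> u \<in> V \<Longrightarrow> d i u > 0 \<Longrightarrow> a u \<le> i + 1"
begin

text \<open>The closed form of the factor \<open>k\<close> for level \<open>i\<close>: slots held by
  the neighbouring level nearer to the origin, or the single slot of \<open>z\<close> when
  \<open>i = 0\<close>.\<close>

definition exits :: "int \<Rightarrow> nat" where
  "exits i = (if i = 0 then 1 else \<Sum>u\<in>level V a (i - sgn i). d i u)"

text \<open>For \<open>i > 0\<close>, an edge leaving a level above \<open>i\<close> descends by at most one, hence it cannot jump over
  level \<open>i\<close>; for \<open>i < 0\<close> the situation is mirrored.\<close>

lemma reaches_level:
  assumes f: "f \<in> partial_trees V z a d J" and "J \<subseteq> L" "i \<in> L" "i \<notin> J"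
    and outer: "\<And>j. j \<in> L \<Longrightarrow> \<bar>i\<bar> < \<bar>j\<bar> \<Longrightarrow> j \<in> J" and inner: "\<And>j. j \<in> J \<Longrightarrow> \<bar>i\<bar> \<le> \<bar>j\<bar>"
    and u: "u \<in> V" "i > 0 \<Longrightarrow> i \<le> a u" "i < 0 \<Longrightarrow> a u \<le> i"
  shows "\<exists>b\<in>level V a i. (u, b) \<in> (fgraph f {v \<in> V. a v \<in> J})\<^sup>*"
proof -
  let ?r = "fgraph f {v \<in> V. a v \<in> J}"
  obtain w where w: "(u, w) \<in> ?r\<^sup>*" "w \<notin> {v \<in> V. a v \<in> J}"
    using fgraph_reaches_exit[of "{v \<in> V. a v \<in> J}" f u] f fin by (auto simp: partial_trees_def)
  from w(1) have "w \<in> V \<and> (i > 0 \<longrightarrow> i \<le> a w) \<and> (i < 0 \<longrightarrow> a w \<le> i)"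
  proof (induction rule: rtrancl_induct)
    case base
    thus ?case using u by auto
  next
    case (step x y)
    hence x: "x \<in> V" "a x \<in> J" "y = f x" by auto
    hence ax: "a x \<in> L" "a x \<noteq> i" using assms(2,4) by auto
    \<comment> \<open>Only level 0 can have \<open>z\<close> as a parent, so the walk stays inside
      \<open>V\<close>.\<close>
    have "a x \<noteq> 0" using inner[OF x(2)] ax(2) by linarith
    have y: "y \<in> insert z V" "d (a x) y > 0" using partial_trees_pos[OF fin f x(1,2)] x by auto
    hence "y \<in> V" using d_root \<open>a x \<noteq> 0\<close> by auto
    moreover have "i > 0 \<Longrightarrow> i \<le> a y" using d_pos[OF ax(1) _ \<open>y \<in> V\<close> y(2)] step ax by auto
    moreover have "i < 0 \<Longrightarrow> a y \<le> i" using d_neg[OF ax(1) _ \<open>y \<in> V\<close> y(2)] step ax by auto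
    ultimately show ?case by blast
  qed
  moreover have "a w \<in> L" "a w \<notin> J" using calculation w L by auto
  \<comment> \<open>The exit lies on the outer side of \<open>i\<close> or at \<open>i\<close>, but
    no farther from the origin than \<open>i\<close>; hence it lies at level
    \<open>i\<close>.\<close>
  moreover have "\<not> \<bar>i\<bar> < \<bar>a w\<bar>" using outer[of "a w"] calculation by blast
  ultimately have "w \<in> level V a i" by (auto simp: level_def)
  thus ?thesis using w by blast
qed

text \<open>A vertex at level \<open>i\<close> or beyond leads back to level \<open>i\<close>. Any
  other vertex of \<open>V\<close> with a slot there sits at level \<open>i - sgn i\<close>, which
  has no parents assigned yet, so it leads nowhere. For \<open>i = 0\<close> only \<open>z\<close>
  is left.\<close>

lemma sum_free:
  assumes f: "f \<in> partial_trees V z a d J" and "J \<subseteq> L" "i \<in> L" "i \<notin> J"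
    and outer: "\<And>j. j \<in> L \<Longrightarrow> \<bar>i\<bar> < \<bar>j\<bar> \<Longrightarrow> j \<in> J" and inner: "\<And>j. j \<in> J \<Longrightarrow> \<bar>i\<bar> \<le> \<bar>j\<bar>"
  shows "(\<Sum>u | u \<in> insert z V \<and> (\<forall>b\<in>level V a i. (u, b) \<notin> (fgraph f {v \<in> V. a v \<in> J})\<^sup>*). d i u) = exits i"
    (is "sum _ ?F = _")
proof -
  let ?r = "fgraph f {v \<in> V. a v \<in> J}"
  have reach: "\<exists>b\<in>level V a i. (u, b) \<in> ?r\<^sup>*" if "u \<in> V" "i > 0 \<Longrightarrow> i \<le> a u" "i < 0 \<Longrightarrow> a u \<le> i" for u
    by (rule reaches_level[OF assms(1-4)]) (use outer inner that in auto)
  have stuck: "w = u" if "(u, w) \<in> ?r\<^sup>*" "u \<notin> V \<or> a u \<notin> J" for u w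
    using that by (auto elim: converse_rtranclE)
  have zF: "z \<in> ?F" using stuck[of z] z by (auto simp: level_def)
  show ?thesis
  proof (cases "i = 0")
    case True
    have "?F = {z}"
    proof -
      have "u \<notin> ?F" if "u \<in> V" for u using reach[of u] that True by auto
      thus ?thesis using zF by auto
    qed
    thus ?thesis using True d_root by (simp add: exits_def)
  next
    case False
    have "sum (d i) ?F = sum (d i) (level V a (i - sgn i))"
    proof (rule sum.mono_neutral_right)
      show "finite ?F" using fin by auto
      show "level V a (i - sgn i) \<subseteq> ?F"
      proof
        fix u assume u: "u \<in> level V a (i - sgn i)"
        have "\<bar>i - sgn i\<bar> < \<bar>i\<bar>" using False by (auto simp: sgn_if)
        hence "a u \<notin> J" using u inner[of "a u"] by (auto simp: level_def)
        moreover have "u \<notin> level V a i"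
          using u \<open>\<bar>i - sgn i\<bar> < \<bar>i\<bar>\<close> unfolding level_def by fastforce
        ultimately have "(u, b) \<notin> ?r\<^sup>*" if "b \<in> level V a i" for b
          using stuck[of u b] that by metis
        thus "u \<in> ?F" using u by (auto simp: level_def)
      qed
      show "\<forall>u\<in>?F - level V a (i - sgn i). d i u = 0"
      proof
        fix u assume u: "u \<in> ?F - level V a (i - sgn i)"
        show "d i u = 0"
        proof (rule ccontr)
          assume pos: "d i u \<noteq> 0"
          hence uV: "u \<in> V" using u d_root False by (auto split: if_splits)
          have "i > 0 \<Longrightarrow> i \<le> a u" using d_pos[OF \<open>i \<in> L\<close> _ uV] pos u uV by (fastforce simp: level_def)
          moreover have "i < 0 \<Longrightarrow> a u \<le> i" using d_neg[OF \<open>i \<in> L\<close> _ uV] pos u uV by (fastforce simp: level_def)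
          ultimately show False using reach[OF uV] u by blast
        qed
      qed
    qed
    thus ?thesis using False by (simp add: exits_def)
  qed
qed

text \<open>Outward-closed sets \<open>J\<close> are built from the outside in. The number of ways
  to fill a new level does not depend on the earlier choices, so the counts multiply.\<close>

lemma card_partial_trees:
  assumes "J \<subseteq> L" "\<And>i j. j \<in> J \<Longrightarrow> i \<in> L \<Longrightarrow> \<bar>j\<bar> < \<bar>i\<bar> \<Longrightarrow> i \<in> J"
  shows "card (partial_trees V z a d J) * (\<Prod>j\<in>J. \<Prod>u\<in>insert z V. fact (d j u)) =
         (\<Prod>j\<in>J. fact (card (level V a j) - 1) * exits j)"
  using assms
proof (induction "card J" arbitrary: J)
  case 0
  have "finite L" using L fin by auto
  hence "J = {}" using 0 by (metis card_0_eq finite_subset)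
  have "partial_trees V z a d {} = {\<lambda>_. undefined}"
    by (auto simp: partial_trees_def acyclic_def)
  thus ?case using \<open>J = {}\<close> by simp
next
  case (Suc N)
  have "finite L" using L fin by auto
  hence fJ: "finite J" using Suc.prems(1) by (rule finite_subset[rotated])
  have "J \<noteq> {}" using Suc by auto
  \<comment> \<open>A level nearest to the origin is the one added last. Of two levels
    \<open>i\<close> and \<open>-i\<close> either may be taken, since the closure condition compares
    absolute values strictly.\<close>
  then obtain i where i: "i \<in> J" "\<And>j. j \<in> J \<Longrightarrow> \<bar>i\<bar> \<le> \<bar>j\<bar>"
    using ex_min_if_finite[of "abs ` J"] fJ by (metis (no_types, lifting) finite_imageI image_iff image_is_empty linorder_not_less)
  define J' where "J' = J - {i}"
  have J: "J = insert i J'" "i \<notin> J'" "J' \<subseteq> L" "i \<in> L" "finite J'" using i Suc.prems fJ by (auto simp: J'_def)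
  have cJ: "N = card J'" using Suc(2) J by simp
  have outer: "j \<in> J'" if "j \<in> L" "\<bar>i\<bar> < \<bar>j\<bar>" for j
    using Suc.prems(2)[OF i(1), of j] that by (auto simp: J'_def)
  have inner: "\<bar>i\<bar> \<le> \<bar>j\<bar>" if "j \<in> J'" for j using i that by (auto simp: J'_def)
  let ?D = "{v \<in> V. a v \<in> J'}" and ?B = "level V a i" and ?T = "insert z V"
  let ?P = "\<lambda>j. (\<Prod>u\<in>?T. fact (d j u)) :: nat"
  let ?G = "\<lambda>f. {g \<in> fibre_funs ?B ?T (d i). acyclic (fgraph f ?D \<union> fgraph g ?B)}"
  have IH: "card (partial_trees V z a d J') * (\<Prod>j\<in>J'. ?P j) = (\<Prod>j\<in>J'. fact (card (level V a j) - 1) * exits j)"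
  proof (rule Suc.hyps(1)[OF cJ J(3)])
    fix k j assume *: "j \<in> J'" "k \<in> L" "\<bar>j\<bar> < \<bar>k\<bar>"
    hence "\<bar>i\<bar> < \<bar>k\<bar>" using inner[of j] by linarith
    thus "k \<in> J'" using outer * by blast
  qed
  have finB: "finite ?B" "?B \<noteq> {}" using fin L J(4) by (auto simp: level_def)
  have block: "card (?G f) * ?P i = fact (card ?B - 1) * exits i" if f: "f \<in> partial_trees V z a d J'" for f
  proof -
    have "card (?G f) * ?P i = fact (card ?B - 1) *
        (\<Sum>u | u \<in> ?T \<and> (\<forall>b\<in>?B. (u, b) \<notin> (fgraph f ?D)\<^sup>*). d i u)"
    proof (rule card_acyclic_fibre_funs)
      show "acyclic (fgraph f ?D)" using f by (simp add: partial_trees_def)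
      show "sum (d i) ?T = card ?B" using d_sum J(4) .
      show "Domain (fgraph f ?D) \<inter> ?B = {}" using J(2) by (auto simp: level_def)
    qed (use fin finB in \<open>auto simp: single_valued_fgraph\<close>)
    also have "(\<Sum>u | u \<in> ?T \<and> (\<forall>b\<in>?B. (u, b) \<notin> (fgraph f ?D)\<^sup>*). d i u) = exits i"
      by (rule sum_free[OF f J(3,4,2)]) (use outer inner in auto)
    finally show ?thesis .
  qed
  have "card (partial_trees V z a d J) = card (SIGMA f:partial_trees V z a d J'. ?G f)"
    unfolding J(1) by (rule bij_betw_same_card[OF partial_trees_insert[OF J(2)], symmetric])
  also have "\<dots> = (\<Sum>f\<in>partial_trees V z a d J'. card (?G f))"
    using fin finB by (intro card_SigmaI) (auto simp: finite_partial_trees finite_fibre_funs)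
  finally have "card (partial_trees V z a d J) * ?P i = (\<Sum>f\<in>partial_trees V z a d J'. card (?G f) * ?P i)"
    by (simp only: sum_distrib_right)
  also have "\<dots> = card (partial_trees V z a d J') * (fact (card ?B - 1) * exits i)"
    using block by simp
  finally have step: "card (partial_trees V z a d J) * ?P i =
     card (partial_trees V z a d J') * (fact (card ?B - 1) * exits i)" .
  have "(\<Prod>j\<in>J. ?P j) = ?P i * (\<Prod>j\<in>J'. ?P j)"
    unfolding J(1) by (rule prod.insert) (use J in auto)
  hence "card (partial_trees V z a d J) * (\<Prod>j\<in>J. ?P j)
      = (card (partial_trees V z a d J) * ?P i) * (\<Prod>j\<in>J'. ?P j)" by (simp only: mult.assoc)
  also have "\<dots> = (fact (card ?B - 1) * exits i) * (card (partial_trees V z a d J') * (\<Prod>j\<in>J'. ?P j))"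
    unfolding step by (simp only: mult_ac)
  also have "\<dots> = (\<Prod>j\<in>J. fact (card (level V a j) - 1) * exits j)"
    unfolding IH J(1) using J by (subst prod.insert) auto
  finally show ?case .
qed

end

section \<open>Rooted trees and parent functions\<close>

lemma is_path_snoc:
  "p \<noteq> [] \<Longrightarrow> is_path E (p @ [w]) \<longleftrightarrow> is_path E p \<and> w \<notin> set p \<and> {last p, w} \<in> E"
  by (auto simp: is_path_def successively_append_iff)

lemma is_path_appendD1: "is_path E (p @ q) \<Longrightarrow> p \<noteq> [] \<Longrightarrow> is_path E p"
  by (auto simp: is_path_def successively_append_iff)

text \<open>If the next vertex already lies on the path, the path is cut off there; otherwise it is
  extended.\<close>

lemma rtrancl_imp_path:
  assumes "(u, v) \<in> {(x, y). {x, y} \<in> E}\<^sup>*"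
  shows "\<exists>p. is_path E p \<and> hd p = u \<and> last p = v"
  using assms
proof (induction rule: rtrancl_induct)
  case base
  show ?case by (rule exI[of _ "[u]"]) (auto simp: is_path_def)
next
  case (step y w)
  then obtain p where p: "is_path E p" "hd p = u" "last p = y" by auto
  have ne: "p \<noteq> []" using p by (auto simp: is_path_def)
  show ?case
  proof (cases "w \<in> set p")
    case True
    then obtain p1 p2 where "p = (p1 @ [w]) @ p2" by (auto dest: split_list)
    moreover from this have "is_path E (p1 @ [w])" using p is_path_appendD1 by blast
    moreover have "hd (p1 @ [w]) = u" using p calculation by (cases p1) auto
    ultimately show ?thesis by fastforce
  next
    case False
    hence "is_path E (p @ [w])" using p step ne by (simp add: is_path_snoc)
    thus ?thesis using p ne by (intro exI[of _ "p @ [w]"]) auto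
  qed
qed

lemma is_path_nth: "is_path E p \<Longrightarrow> Suc i < length p \<Longrightarrow> {p ! i, p ! Suc i} \<in> E"
  by (auto simp: is_path_def successively_conv_nth)

lemma is_cycle_neighbours:
  assumes "is_cycle E p" "x \<in> set p"
  obtains y y' where "y \<in> set p" "y' \<in> set p" "y \<noteq> y'" "{x, y} \<in> E" "{x, y'} \<in> E"
proof -
  let ?n = "length p"
  have p: "?n \<ge> 3" "distinct p" "is_path E p" "{last p, hd p} \<in> E"
    using assms by (auto simp: is_cycle_def is_path_def)
  obtain i where i: "i < ?n" "x = p ! i" using assms by (metis in_set_conv_nth)
  have wrap: "{p ! (?n - 1), p ! 0} \<in> E" using p by (metis hd_conv_nth last_conv_nth list.size(3) not_numeral_le_zero)
  \<comment> \<open>Indices of the cyclic successor and predecessor; they differ because the length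
    is at least 3.\<close>
  define j where "j = (if i = ?n - 1 then 0 else Suc i)"
  define k where "k = (if i = 0 then ?n - 1 else i - 1)"
  have "{p ! i, p ! j} \<in> E" using is_path_nth[OF p(3), of i] wrap i by (auto simp: j_def)
  moreover have "{p ! i, p ! k} \<in> E"
    using is_path_nth[OF p(3), of "i - 1"] wrap i by (auto simp: k_def insert_commute)
  moreover have "j < ?n" "k < ?n" "j \<noteq> k" using i p by (auto simp: j_def k_def)
  moreover from this have "p ! j \<noteq> p ! k" using p(2) by (simp add: nth_eq_iff_index_eq)
  ultimately show ?thesis using that i by (meson nth_mem)
qed

section \<open>Parent functions and the trees they define\<close>

definition parent_edges :: "'a set \<Rightarrow> 'a \<Rightarrow> ('a \<Rightarrow> 'a) \<Rightarrow> 'a set set" where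
  "parent_edges V z f = {{v, f v} |v. v \<in> V \<and> f v \<noteq> z}"

locale parent_function =
  fixes V :: "'a set" and z \<rho> :: 'a and f :: "'a \<Rightarrow> 'a"
  assumes fin: "finite V" and z: "z \<notin> V" and f: "f ` V \<subseteq> insert z V"
    and root: "\<rho> \<in> V" "\<And>v. v \<in> V \<Longrightarrow> f v = z \<longleftrightarrow> v = \<rho>"
    and acyc: "acyclic (fgraph f V)"
begin

lemma edge_iff: "{x, y} \<in> parent_edges V z f \<longleftrightarrow> (x \<in> V \<and> y = f x \<and> y \<noteq> z) \<or> (y \<in> V \<and> x = f y \<and> x \<noteq> z)"
  by (auto simp: parent_edges_def doubleton_eq_iff)

lemma f_in: "v \<in> V \<Longrightarrow> v \<noteq> \<rho> \<Longrightarrow> f v \<in> V"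
  using f root by auto

lemma f_neq: "v \<in> V \<Longrightarrow> f v \<noteq> v"
proof
  assume "v \<in> V" "f v = v"
  hence "(v, v) \<in> (fgraph f V)\<^sup>+" by (intro r_into_trancl') auto
  thus False using acyc by (auto simp: acyclic_def)
qed

text \<open>That all vertices on the path are ancestors of \<open>w\<close> strengthens the
  induction: a vertex is no proper ancestor of itself, so appending a child keeps the path
  distinct.\<close>

lemma path_from_root:
  assumes "w \<in> V"
  shows "\<exists>p. is_path (parent_edges V z f) p \<and> hd p = \<rho> \<and> last p = w \<and> (\<forall>x\<in>set p. (w, x) \<in> (fgraph f V)\<^sup>*)"
proof -
  have "wf ((fgraph f V)\<inverse>)" using fin acyc by (simp add: finite_acyclic_wf_converse)
  thus ?thesis using assms
  proof (induction w rule: wf_induct_rule)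
    case (less w)
    show ?case
    proof (cases "w = \<rho>")
      case True
      thus ?thesis by (intro exI[of _ "[\<rho>]"]) (auto simp: is_path_def)
    next
      case False
      obtain p where p: "is_path (parent_edges V z f) p" "hd p = \<rho>" "last p = f w"
        "\<forall>x\<in>set p. (f w, x) \<in> (fgraph f V)\<^sup>*"
        using less.IH[of "f w"] less.prems f_in[OF less.prems False] by auto
      have ne: "p \<noteq> []" using p by (auto simp: is_path_def)
      have e: "(w, f w) \<in> fgraph f V" using less.prems by auto
      have "w \<notin> set p"
      proof
        assume "w \<in> set p"
        hence "(w, w) \<in> (fgraph f V)\<^sup>+" using p(4) e by (meson rtrancl_into_trancl2)
        thus False using acyc by (auto simp: acyclic_def)
      qed
      hence "is_path (parent_edges V z f) (p @ [w])"
        using p ne less.prems False root z f_in by (auto simp: is_path_snoc edge_iff)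
      moreover have "\<forall>x\<in>set (p @ [w]). (w, x) \<in> (fgraph f V)\<^sup>*"
        using p(4) e by (auto intro: converse_rtrancl_into_rtrancl)
      ultimately show ?thesis using p ne by (intro exI[of _ "p @ [w]"]) auto
    qed
  qed
qed

text \<open>The first edge leaves the root downwards. Once \<open>v\<close> has been entered from
  its parent, a path cannot return there, so the next edge leads to a child of
  \<open>v\<close>.\<close>

lemma path_descends:
  assumes "is_path (parent_edges V z f) (q @ [v, w])" "hd (q @ [v, w]) = \<rho>"
  shows "w \<in> V \<and> f w = v \<and> v \<in> V"
  using assms
proof (induction q arbitrary: v w rule: rev_induct)
  case Nil
  hence "{\<rho>, w} \<in> parent_edges V z f" "v = \<rho>" by (auto simp: is_path_def)
  thus ?case using root by (auto simp: edge_iff)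
next
  case (snoc u q)
  have "is_path (parent_edges V z f) (q @ [u, v])" using snoc.prems is_path_appendD1[of _ "q @ [u, v]" "[w]"] by simp
  hence IH: "v \<in> V" "f v = u" "u \<in> V" using snoc.IH[of u v] snoc.prems by (auto simp: hd_append split: if_splits)
  have "{v, w} \<in> parent_edges V z f" "u \<noteq> w"
    using snoc.prems by (auto simp: is_path_def successively_append_iff)
  thus ?case using IH by (auto simp: edge_iff)
qed

text \<open>This links the path-based notion of a child to \<open>f\<close>. For the converse
  direction, the path to \<open>v\<close> consists of ancestors of \<open>v\<close>, so it does not
  contain \<open>w\<close>.\<close>

lemma is_child_iff: "is_child (parent_edges V z f) \<rho> v w \<longleftrightarrow> w \<in> V \<and> f w = v \<and> v \<noteq> z"
proof
  assume "is_child (parent_edges V z f) \<rho> v w"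
  thus "w \<in> V \<and> f w = v \<and> v \<noteq> z" using path_descends z unfolding is_child_def by blast
next
  assume w: "w \<in> V \<and> f w = v \<and> v \<noteq> z"
  obtain p where p: "is_path (parent_edges V z f) p" "hd p = \<rho>" "last p = v" "\<forall>x\<in>set p. (v, x) \<in> (fgraph f V)\<^sup>*"
    using path_from_root[of v] f w by auto
  have ne: "p \<noteq> []" using p by (auto simp: is_path_def)
  have "w \<notin> set p"
  proof
    assume "w \<in> set p"
    hence "(w, w) \<in> (fgraph f V)\<^sup>+" using p(4) w by (auto intro: rtrancl_into_trancl2)
    thus False using acyc by (auto simp: acyclic_def)
  qed
  hence "is_path (parent_edges V z f) (p @ [w])" using p ne w by (auto simp: is_path_snoc edge_iff)
  moreover have "p = butlast p @ [v]" using p ne by (metis append_butlast_last_id)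
  ultimately have "is_path (parent_edges V z f) (butlast p @ [v, w])" by (metis append.assoc append_Cons append_Nil)
  moreover have "hd (butlast p @ [v, w]) = \<rho>" using \<open>p = butlast p @ [v]\<close> p(2) by (metis hd_append list.sel(1))
  ultimately show "is_child (parent_edges V z f) \<rho> v w" unfolding is_child_def by blast
qed

text \<open>Connectedness goes through the root. On a cycle, a vertex without children on the cycle
  would have its parent as both of its distinct neighbours.\<close>

lemma is_tree_parent_edges: "is_tree V (parent_edges V z f)"
  unfolding is_tree_def
proof (intro conjI ballI notI)
  let ?E = "parent_edges V z f"
  show "V = {} \<Longrightarrow> False" using root by auto
  fix e assume "e \<in> ?E"
  then obtain v where v: "v \<in> V" "f v \<noteq> z" "e = {v, f v}" by (auto simp: parent_edges_def)
  thus "e \<subseteq> V" using f by auto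
  show "card e = 2" using v f_neq[of v] by auto
next
  let ?E = "parent_edges V z f"
  let ?r = "{(x, y). {x, y} \<in> ?E}"
  have sym: "sym (?r\<^sup>*)" by (rule sym_rtrancl) (auto simp: sym_def insert_commute)
  have *: "(\<rho>, w) \<in> ?r\<^sup>*" if "w \<in> V" for w
  proof -
    have "wf ((fgraph f V)\<inverse>)" using fin acyc by (simp add: finite_acyclic_wf_converse)
    thus ?thesis using that
    proof (induction w rule: wf_induct_rule)
      case (less w)
      show ?case
      proof (cases "w = \<rho>")
        case False
        hence "(\<rho>, f w) \<in> ?r\<^sup>*" using less f_in by auto
        moreover have "(f w, w) \<in> ?r" using less False root by (auto simp: edge_iff)
        ultimately show ?thesis by (rule rtrancl_into_rtrancl)
      qed auto
    qed
  qed
  fix u v assume "u \<in> V" "v \<in> V"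
  hence "(u, v) \<in> ?r\<^sup>*" using *[of u] *[of v] sym by (meson rtrancl_trans symD)
  thus "\<exists>p. is_path ?E p \<and> hd p = u \<and> last p = v" by (rule rtrancl_imp_path)
next
  let ?E = "parent_edges V z f"
  assume "\<exists>p. is_cycle ?E p"
  then obtain p where p: "is_cycle ?E p" by auto
  hence "set p \<noteq> {}" by (auto simp: is_cycle_def)
  moreover have "wf (fgraph f V)" using fin acyc by (simp add: finite_acyclic_wf)
  ultimately obtain x where x: "x \<in> set p" "\<And>y. (y, x) \<in> fgraph f V \<Longrightarrow> y \<notin> set p"
    by (metis wfE_min all_not_in_conv)
  obtain y y' where y: "y \<in> set p" "y' \<in> set p" "y \<noteq> y'" "{x, y} \<in> ?E" "{x, y'} \<in> ?E"
    using is_cycle_neighbours[OF p x(1)] .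
  have "y = f x" "y' = f x" using y x(2) by (auto simp: edge_iff)
  thus False using y by auto
qed

end

text \<open>An additional edge of \<open>E\<close> would close the path of \<open>E'\<close> between
  its ends to a cycle in \<open>E\<close>.\<close>

lemma tree_eq_of_subset:
  assumes "is_tree V E" "is_tree V E'" "E' \<subseteq> E"
  shows "E' = E"
proof (rule ccontr)
  assume "E' \<noteq> E"
  then obtain e where e: "e \<in> E" "e \<notin> E'" using assms by auto
  hence "e \<subseteq> V" "card e = 2" using assms by (auto simp: is_tree_def)
  then obtain x y where xy: "e = {x, y}" "x \<noteq> y" "x \<in> V" "y \<in> V" by (metis card_2_iff insert_subset)
  then obtain p where p: "is_path E' p" "hd p = x" "last p = y" using assms(2) unfolding is_tree_def by blast
  have "length p \<ge> 3"
  proof (rule ccontr)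
    assume "\<not> length p \<ge> 3"
    moreover have "p \<noteq> []" using p by (auto simp: is_path_def)
    ultimately consider u where "p = [u]" | u v where "p = [u, v]"
      by (cases p; cases "tl p"; cases "tl (tl p)") auto
    thus False by cases (use p xy e in \<open>auto simp: is_path_def\<close>)
  qed
  moreover have "is_path E p" using p(1) assms(3) unfolding is_path_def by (auto elim: successively_mono)
  moreover have "{last p, hd p} \<in> E" using p e xy by (simp add: insert_commute)
  ultimately have "is_cycle E p" by (simp add: is_cycle_def)
  thus False using assms(1) by (auto simp: is_tree_def)
qed

text \<open>Parents are chosen along shortest paths from the root; uniqueness of paths is not needed, as the
  chosen edges already form a tree.\<close>

lemma tree_obtain_parent_function:
  assumes "is_tree V E" "\<rho> \<in> V" "finite V" "z \<notin> V"
  obtains f where "f \<in> V \<rightarrow>\<^sub>E insert z V" "parent_function V z \<rho> f" "E = parent_edges V z f"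
proof -
  define P where "P w p \<longleftrightarrow> is_path E p \<and> hd p = \<rho> \<and> last p = w" for w p
  \<comment> \<open>The number of vertices on a shortest path from the root; parents will be
    neighbours with a smaller value.\<close>
  define h where "h w = (LEAST k. \<exists>p. P w p \<and> length p = k)" for w
  have ex: "\<exists>v. v \<in> V \<and> {v, w} \<in> E \<and> h v < h w" if w: "w \<in> V" "w \<noteq> \<rho>" for w
  proof -
    have "\<exists>k p. P w p \<and> length p = k" using assms w unfolding is_tree_def P_def by blast
    hence "\<exists>p. P w p \<and> length p = h w" unfolding h_def by (rule LeastI_ex)
    then obtain p where p: "is_path E p" "hd p = \<rho>" "last p = w" "length p = h w" by (auto simp: P_def)
    have "p \<noteq> []" using p by (auto simp: is_path_def)
    then obtain q where q: "p = q @ [w]" using p by (metis append_butlast_last_id)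
    have "q \<noteq> []" using p q w by auto
    hence qp: "is_path E q" "{last q, w} \<in> E" using p q by (auto simp: is_path_snoc)
    have "P (last q) q" using qp p q \<open>q \<noteq> []\<close> by (auto simp: P_def)
    hence "h (last q) \<le> length q" unfolding h_def by (intro Least_le) auto
    also have "\<dots> < h w" using p q by auto
    finally have "h (last q) < h w" .
    moreover have "last q \<in> V" using qp assms by (auto simp: is_tree_def)
    ultimately show ?thesis using qp by blast
  qed
  define f where "f = (\<lambda>w\<in>V. if w = \<rho> then z else SOME v. v \<in> V \<and> {v, w} \<in> E \<and> h v < h w)"
  have f: "f w \<in> V" "{f w, w} \<in> E" "h (f w) < h w" if "w \<in> V" "w \<noteq> \<rho>" for w
    using someI_ex[OF ex[OF that]] that by (auto simp: f_def)
  have froot: "f \<rho> = z" using assms by (simp add: f_def)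
  have "acyclic (fgraph f V)"
  proof -
    \<comment> \<open>A chain of parents either lowers \<open>h\<close> strictly or has ended in
      \<open>z\<close>, which has no outgoing edge.\<close>
    have *: "y = z \<and> x \<in> V \<or> x \<in> V \<and> y \<in> V \<and> h y < h x" if "(x, y) \<in> (fgraph f V)\<^sup>+" for x y
      using that
    proof (induction rule: trancl_induct)
      case (base y)
      thus ?case using f[of x] froot by (cases "x = \<rho>") auto
    next
      case (step y w)
      hence "y \<in> V" "w = f y" by auto
      thus ?case using f[of y] froot step assms(4) by (cases "y = \<rho>") auto
    qed
    show ?thesis unfolding acyclic_def using * assms(4) by fastforce
  qed
  moreover have "f \<in> V \<rightarrow>\<^sub>E insert z V" using f(1) froot by (auto simp: f_def)
  moreover have pf: "parent_function V z \<rho> f"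
    using assms calculation f froot by unfold_locales (auto, metis)
  moreover have "parent_edges V z f = E"
  proof (rule tree_eq_of_subset[OF assms(1)])
    show "is_tree V (parent_edges V z f)" using pf by (rule parent_function.is_tree_parent_edges)
    show "parent_edges V z f \<subseteq> E"
      using f(2) froot by (fastforce simp: parent_edges_def insert_commute)
  qed
  ultimately show ?thesis using that by auto
qed

section \<open>Embedded Cayley trees with given in-types\<close>

text \<open>\<open>level_pos\<close> makes \<open>{l..r}\<close> exactly the set of occupied levels,
  and \<open>outside\<close> keeps every prescribed child within them.\<close>

locale profile =
  fixes m l r :: int and n :: "int \<Rightarrow> (int \<Rightarrow> nat) \<Rightarrow> nat"
  assumes m_le: "m \<le> 1"
    and n_ext: "\<And>i c. n i c > 0 \<Longrightarrow> c \<in> {m..1} \<rightarrow>\<^sub>E UNIV"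
    and n_fin: "finite {(i, c). n i c > 0}"
    and level_pos: "\<And>i. level_count n i > 0 \<longleftrightarrow> i \<in> {l..r}"
    and compat: "\<And>i. i \<in> {l..r} \<Longrightarrow>
           of_bool (i = 0) + (\<Sum>s\<in>{m..1}. step_count n i s) = level_count n i"
    and outside: "\<And>i s. i \<notin> {l..r} \<Longrightarrow> s \<in> {m..1} \<Longrightarrow> step_count n i s = 0"
    and steps: "m = -1 \<or> (\<forall>i<0. \<forall>c. n i c = 0)"
begin

abbreviation "S \<equiv> {m..1}"

definition V :: "nat set" where "V = {1..total_count n}"

lemma V_simps [simp]: "finite V" "card V = total_count n" "0 \<notin> V"
  by (auto simp: V_def)

definition types :: "(int \<times> (int \<Rightarrow> nat)) set" where
  "types = {(i, c). n i c > 0}"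

definition labellings :: "(nat \<Rightarrow> int \<times> (int \<Rightarrow> nat)) set" where
  "labellings = fibre_funs V types (\<lambda>(i, c). n i c)"

text \<open>The number of children at level \<open>i\<close> that vertex \<open>u\<close> must have; \<open>0 \<notin> V\<close> plays the role of the virtual
  parent of the root.\<close>

definition demand :: "(nat \<Rightarrow> int \<times> (int \<Rightarrow> nat)) \<Rightarrow> int \<Rightarrow> nat \<Rightarrow> nat" where
  "demand t i u = (if u = 0 then of_bool (i = 0)
     else if i - fst (t u) \<in> S then snd (t u) (i - fst (t u)) else 0)"

lemma demand_V: "u \<in> V \<Longrightarrow> demand t i u = (if i - fst (t u) \<in> S then snd (t u) (i - fst (t u)) else 0)"
  by (auto simp: demand_def V_def)

lemma finite_types: "finite types" using n_fin by (simp add: types_def)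

lemma finite_types_at: "finite {c. n i c > 0}"
  by (rule finite_subset[of _ "snd ` types"]) (use finite_types in \<open>force simp: types_def\<close>)+

lemma sum_types_at:
  "(\<Sum>(j, c)\<in>types. n j c * (if j = i then g c else 0)) = (\<Sum>c | n i c > 0. n i c * g c)"
proof -
  have "(\<Sum>c | n i c > 0. n i c * g c) = (\<Sum>(j, c)\<in>Pair i ` {c. n i c > 0}. n j c * (if j = i then g c else 0))"
    by (subst sum.reindex) (auto simp: inj_on_def)
  also have "\<dots> = (\<Sum>(j, c)\<in>types. n j c * (if j = i then g c else 0))"
    using finite_types by (intro sum.mono_neutral_left) (auto simp: types_def)
  finally show ?thesis ..
qed

lemma total_count_types: "total_count n = (\<Sum>(i, c)\<in>types. n i c)"
proof -
  have "types = (SIGMA i:{i. level_count n i > 0}. {c. n i c > 0})"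
    using finite_types_at unfolding types_def level_count_def by (auto simp: card_gt_0_iff intro!: sum_pos2)
  thus ?thesis unfolding total_count_def level_count_def
    using finite_types_at level_pos[unfolded level_count_def]
    by (subst sum.Sigma) auto
qed

lemma card_labellings: "card labellings * (\<Prod>(i, c)\<in>types. fact (n i c)) = fact (total_count n)"
  using card_fibre_funs[of V types "\<lambda>(i, c). n i c"] finite_types total_count_types
  by (simp add: labellings_def case_prod_unfold)

text \<open>Values outside the support have empty fibres, so the condition may range over all
  \<open>(i, c)\<close>, as it does for the in-types of a tree.\<close>

lemma labelling_iff:
  "t \<in> labellings \<longleftrightarrow> t \<in> extensional V \<and> (\<forall>i c. card {v \<in> V. t v = (i, c)} = n i c)"
proof
  assume t: "t \<in> labellings"
  have "card {v \<in> V. t v = (i, c)} = n i c" for i c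
  proof (cases "(i, c) \<in> types")
    case True
    thus ?thesis using t by (auto simp: labellings_def fibre_funs_def)
  next
    case False
    moreover from this have "{v \<in> V. t v = (i, c)} = {}"
      using t by (auto simp: labellings_def fibre_funs_def PiE_iff dest: bspec)
    ultimately show ?thesis by (simp add: types_def)
  qed
  thus "t \<in> extensional V \<and> (\<forall>i c. card {v \<in> V. t v = (i, c)} = n i c)"
    using t by (auto simp: labellings_def fibre_funs_def PiE_iff)
next
  assume t: "t \<in> extensional V \<and> (\<forall>i c. card {v \<in> V. t v = (i, c)} = n i c)"
  have "t v \<in> types" if "v \<in> V" for v
  proof -
    have "v \<in> {w \<in> V. t w = (fst (t v), snd (t v))}" using that by auto
    hence "card {w \<in> V. t w = (fst (t v), snd (t v))} > 0" by (subst card_gt_0_iff) auto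
    thus ?thesis using conjunct2[OF t, rule_format, of "fst (t v)" "snd (t v)"]
      by (simp add: types_def case_prod_unfold)
  qed
  thus "t \<in> labellings" using t by (auto simp: labellings_def fibre_funs_def PiE_iff)
qed

section \<open>Counting the parent functions for a fixed labelling\<close>

context
  fixes t :: "nat \<Rightarrow> int \<times> (int \<Rightarrow> nat)"
  assumes t: "t \<in> labellings"
begin

lemma t_type: "v \<in> V \<Longrightarrow> n (fst (t v)) (snd (t v)) > 0"
  using t by (auto simp: labellings_def fibre_funs_def PiE_iff types_def case_prod_unfold)

text \<open>Grouping the vertices by type turns vertex sums into sums that depend on
  \<open>n\<close> only.\<close>

lemma sum_labelling: "(\<Sum>v\<in>V. h (t v)) = (\<Sum>(i, c)\<in>types. n i c * h (i, c))"
proof -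
  have "(\<Sum>v\<in>V. h (t v)) = (\<Sum>y\<in>types. \<Sum>v\<in>{v \<in> V. t v = y}. h (t v))"
    using finite_types t_type by (intro sum.group[symmetric]) (auto simp: types_def case_prod_unfold)
  also have "\<dots> = (\<Sum>(i, c)\<in>types. n i c * h (i, c))"
    using t unfolding labelling_iff by (intro sum.cong) auto
  finally show ?thesis .
qed

lemma sum_level: "(\<Sum>v\<in>level V (fst \<circ> t) i. g (snd (t v))) = (\<Sum>c | n i c > 0. n i c * g c)"
proof -
  have "(\<Sum>v\<in>level V (fst \<circ> t) i. g (snd (t v))) = (\<Sum>v\<in>V. if fst (t v) = i then g (snd (t v)) else 0)"
    unfolding level_def by (simp add: sum.inter_filter)
  also have "\<dots> = (\<Sum>(j, c)\<in>types. n j c * (if j = i then g c else 0))"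
    using sum_labelling[of "\<lambda>p. if fst p = i then g (snd p) else 0"] by (simp cong: if_cong)
  finally show ?thesis using sum_types_at by simp
qed

lemma card_level: "card (level V (fst \<circ> t) i) = level_count n i"
  using sum_level[of "\<lambda>_. 1" i] by (simp add: level_count_def)

lemma sum_level_step: "(\<Sum>v\<in>level V (fst \<circ> t) (i - s). snd (t v) s) = step_count n i s"
  using sum_level[of "\<lambda>c. c s" "i - s"] by (simp add: step_count_def mult.commute)

lemma levels: "(fst \<circ> t) ` V = {l..r}"
proof -
  have "i \<in> (fst \<circ> t) ` V \<longleftrightarrow> level V (fst \<circ> t) i \<noteq> {}" for i by (auto simp: level_def)
  moreover have "level V (fst \<circ> t) i \<noteq> {} \<longleftrightarrow> card (level V (fst \<circ> t) i) > 0" for i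
    by (auto simp: card_gt_0_iff level_def)
  ultimately have "i \<in> (fst \<circ> t) ` V \<longleftrightarrow> i \<in> {l..r}" for i
    using card_level level_pos by metis
  thus ?thesis by blast
qed

text \<open>The vanishing step count is a sum of naturals over the level of \<open>v\<close>, so
  each of its terms vanishes.\<close>

lemma outside_zero:
  assumes "v \<in> V" "s \<in> S" "fst (t v) + s \<notin> {l..r}"
  shows "snd (t v) s = 0"
proof -
  have "step_count n (fst (t v) + s) s = 0" using outside assms by blast
  hence "(\<Sum>u\<in>level V (fst \<circ> t) (fst (t v)). snd (t u) s) = 0"
    using sum_level_step[where i = "fst (t v) + s" and s = s] by (simp only: add_diff_cancel_right')
  thus ?thesis using assms by (auto simp: level_def)
qed

text \<open>Sorting the demands by the step \<open>s\<close> gives the step counts, and the virtual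
  vertex adds the term for \<open>i = 0\<close>; this is the compatibility condition.\<close>

lemma sum_demand:
  assumes "i \<in> {l..r}"
  shows "sum (demand t i) (insert 0 V) = card (level V (fst \<circ> t) i)"
proof -
  have "sum (demand t i) V = (\<Sum>u\<in>V. \<Sum>s\<in>S. if s = i - fst (t u) then snd (t u) s else 0)"
    by (intro sum.cong refl) (simp add: demand_V)
  also have "\<dots> = (\<Sum>s\<in>S. \<Sum>u\<in>V. if s = i - fst (t u) then snd (t u) s else 0)" by (rule sum.swap)
  also have "\<dots> = (\<Sum>s\<in>S. \<Sum>u\<in>level V (fst \<circ> t) (i - s). snd (t u) s)"
    unfolding level_def by (rule sum.cong[OF refl], subst sum.inter_filter) (auto intro!: sum.cong)
  also have "\<dots> = (\<Sum>s\<in>S. step_count n i s)" by (simp only: sum_level_step)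
  finally show ?thesis using compat[OF assms] by (simp add: card_level demand_def)
qed

lemma m_minus_one:
  assumes "i \<in> {l..r}" "i < 0"
  shows "m = -1"
proof -
  have "level_count n i > 0" using assms level_pos by blast
  thus ?thesis using steps assms by (auto simp: level_count_def)
qed

text \<open>Steps are at most 1, which bounds descent from positive levels. If a negative level
  occurs then \<open>m = -1\<close>, which gives the mirrored bound.\<close>

lemma level_system_labelling: "level_system V 0 (fst \<circ> t) (demand t) {l..r}"
proof
  show "i - 1 \<le> (fst \<circ> t) u" if "i \<in> {l..r}" "0 < i" "u \<in> V" "0 < demand t i u" for i u
    using that by (auto simp: demand_def split: if_splits)
  show "(fst \<circ> t) u \<le> i + 1" if "i \<in> {l..r}" "i < 0" "u \<in> V" "0 < demand t i u" for i u
  proof -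
    have "i - fst (t u) \<ge> m" using that by (auto simp: demand_def split: if_splits)
    thus ?thesis using m_minus_one[OF that(1,2)] by simp
  qed
qed (use sum_demand levels in \<open>auto simp: demand_def\<close>)

lemma prod_exits:
  assumes "0 \<in> {l..r}"
  shows "(\<Prod>i\<in>{l..r}. level_system.exits V (fst \<circ> t) (demand t) i) =
         (\<Prod>i\<in>{l..-1}. step_count n i (-1)) * (\<Prod>i\<in>{1..r}. step_count n i 1)"
proof -
  let ?x = "level_system.exits V (fst \<circ> t) (demand t)"
  note x = level_system.exits_def[OF level_system_labelling]
  have step: "(\<Sum>u\<in>level V (fst \<circ> t) (i - s). demand t i u) = step_count n i s" if "s \<in> S" for i s
    unfolding sum_level_step[symmetric] using that by (intro sum.cong) (auto simp: level_def demand_def)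
  have pos: "?x i = step_count n i 1" if "i \<in> {1..r}" for i
    unfolding x using that step[of 1 i] m_le by simp
  have neg: "?x i = step_count n i (-1)" if "i \<in> {l..-1}" for i
  proof -
    \<comment> \<open>This puts the step -1 into \<open>S\<close>, so that \<open>exits\<close> at a
      negative level is a step count.\<close>
    have "m = -1" using that assms by (intro m_minus_one[of i]) auto
    thus ?thesis unfolding x using that step[of "-1" i] by simp
  qed
  have "{l..r} = {l..-1} \<union> ({0} \<union> {1..r})" using assms by auto
  hence "(\<Prod>i\<in>{l..r}. ?x i) = (\<Prod>i\<in>{l..-1}. ?x i) * (\<Prod>i\<in>{0} \<union> {1..r}. ?x i)"
    by (simp only:) (rule prod.union_disjoint, auto)
  also have "(\<Prod>i\<in>{0} \<union> {1..r}. ?x i) = ?x 0 * (\<Prod>i\<in>{1..r}. ?x i)" by simp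
  also have "?x 0 = 1" unfolding x by simp
  also have "1 * (\<Prod>i\<in>{1..r}. ?x i) = (\<Prod>i\<in>{1..r}. step_count n i 1)"
    using pos by (simp only: mult_1 cong: prod.cong)
  also have "(\<Prod>i\<in>{l..-1}. ?x i) = (\<Prod>i\<in>{l..-1}. step_count n i (-1))"
    using neg by (rule prod.cong[OF refl])
  finally show ?thesis .
qed

lemma card_children: "card {u \<in> V. snd (t u) s = b} = children_count n s b"
proof -
  have "card {u \<in> V. snd (t u) s = b} = (\<Sum>u\<in>V. if snd (t u) s = b then 1 else 0)"
    by (simp add: sum.inter_filter[symmetric])
  also have "\<dots> = (\<Sum>(i, c)\<in>types. n i c * (if c s = b then 1 else 0))"
    using sum_labelling[of "\<lambda>p. if snd p s = b then 1 else 0"] by simp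
  also have "\<dots> = children_count n s b"
    unfolding children_count_def using finite_types
    by (intro sum.mono_neutral_cong_right) (auto simp: types_def split: if_splits)
  finally show ?thesis .
qed

text \<open>Vertices are grouped by their number \<open>b\<close> of children at step
  \<open>s\<close>; the \<open>b\<close> of positive count are exactly the values attained.\<close>

lemma prod_children:
  "(\<Prod>u\<in>V. fact (snd (t u) s)) = (\<Prod>b | children_count n s b > 0. fact b ^ children_count n s b :: nat)"
proof -
  have im: "{b. children_count n s b > 0} = (\<lambda>u. snd (t u) s) ` V"
    unfolding card_children[symmetric] by (auto simp: card_gt_0_iff)
  have "(\<Prod>u\<in>V. fact (snd (t u) s)) =
      (\<Prod>b | children_count n s b > 0. \<Prod>u\<in>{u \<in> V. snd (t u) s = b}. fact (snd (t u) s) :: nat)"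
    unfolding im by (intro prod.group[symmetric]) auto
  also have "\<dots> = (\<Prod>b | children_count n s b > 0. fact b ^ children_count n s b)"
    by (intro prod.cong refl) (simp add: card_children)
  finally show ?thesis .
qed

text \<open>For a fixed vertex, levels and steps correspond by \<open>i = fst (t u) + s\<close>.
  Where the two ranges differ, the demand or the child count is 0 and its factorial is 1.\<close>

lemma prod_demand:
  "(\<Prod>i\<in>{l..r}. \<Prod>u\<in>insert 0 V. fact (demand t i u)) =
   (\<Prod>s\<in>S. \<Prod>b | children_count n s b > 0. fact b ^ children_count n s b :: nat)"
proof -
  have "(\<Prod>i\<in>{l..r}. \<Prod>u\<in>insert 0 V. fact (demand t i u)) =
      (\<Prod>i\<in>{l..r}. \<Prod>u\<in>V. fact (demand t i u) :: nat)"
    by (rule prod.cong[OF refl], subst prod.insert) (auto simp: demand_def)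
  also have "\<dots> = (\<Prod>u\<in>V. \<Prod>i\<in>{l..r}. fact (demand t i u))" by (rule prod.swap)
  also have "\<dots> = (\<Prod>u\<in>V. \<Prod>s\<in>S. fact (snd (t u) s))"
  proof (rule prod.cong[OF refl])
    fix u assume u: "u \<in> V"
    have "(\<Prod>s\<in>S. fact (snd (t u) s)) =
        (\<Prod>i\<in>(\<lambda>s. fst (t u) + s) ` S. fact (snd (t u) (i - fst (t u))) :: nat)"
      by (subst prod.reindex) auto
    also have "\<dots> = (\<Prod>i\<in>{l..r}. fact (demand t i u))"
    proof (rule prod.mono_neutral_cong)
      show "fact (snd (t u) (i - fst (t u))) = (1 :: nat)" if "i \<in> (\<lambda>s. fst (t u) + s) ` S - {l..r}" for i
        using that outside_zero[OF u, of "i - fst (t u)"] by auto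
      show "fact (demand t i u) = (1 :: nat)" if "i \<in> {l..r} - (\<lambda>s. fst (t u) + s) ` S" for i
      proof -
        have "i - fst (t u) \<notin> S"
        proof
          assume "i - fst (t u) \<in> S"
          hence "fst (t u) + (i - fst (t u)) \<in> (\<lambda>s. fst (t u) + s) ` S" by (rule imageI)
          thus False using that by simp
        qed
        thus ?thesis using u by (auto simp: demand_V)
      qed
    qed (use u in \<open>auto simp: demand_V\<close>)
    finally show "(\<Prod>i\<in>{l..r}. fact (demand t i u)) = (\<Prod>s\<in>S. fact (snd (t u) s) :: nat)" ..
  qed
  also have "\<dots> = (\<Prod>s\<in>S. \<Prod>u\<in>V. fact (snd (t u) s))" by (rule prod.swap)
  finally show ?thesis by (simp only: prod_children)
qed

lemma card_trees_of_labelling: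
  assumes "0 \<in> {l..r}"
  shows "card (partial_trees V 0 (fst \<circ> t) (demand t) {l..r}) *
           (\<Prod>s\<in>S. \<Prod>b | children_count n s b > 0. fact b ^ children_count n s b) =
         (\<Prod>i\<in>{l..r}. fact (level_count n i - 1)) *
           ((\<Prod>i\<in>{l..-1}. step_count n i (-1)) * (\<Prod>i\<in>{1..r}. step_count n i 1))"
  using level_system.card_partial_trees[OF level_system_labelling, of "{l..r}"]
  unfolding prod.distrib prod_exits[OF assms] card_level prod_demand by simp

end

section \<open>The bijection between embedded trees and labellings with parent functions\<close>

definition trees :: "(nat set set \<times> nat \<times> (nat \<Rightarrow> int)) set" where
  "trees = {(E, \<rho>, a) \<in> embedded_cayley_trees S (total_count n).
     \<forall>i c. card {v \<in> {1..total_count n}. in_type S E \<rho> a v = (i, c)} = n i c}"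

definition tree_of :: "(nat \<Rightarrow> int \<times> (int \<Rightarrow> nat)) \<times> (nat \<Rightarrow> nat) \<Rightarrow> nat set set \<times> nat \<times> (nat \<Rightarrow> int)" where
  "tree_of = (\<lambda>(t, f). (parent_edges V 0 f, THE \<rho>. \<rho> \<in> V \<and> f \<rho> = 0, restrict (fst \<circ> t) V))"

definition parent_structures :: "((nat \<Rightarrow> int \<times> (int \<Rightarrow> nat)) \<times> (nat \<Rightarrow> nat)) set" where
  "parent_structures = (SIGMA t:labellings. partial_trees V 0 (fst \<circ> t) (demand t) {l..r})"

lemma trees_iff:
  "(E, \<rho>, a) \<in> trees \<longleftrightarrow> is_tree V E \<and> \<rho> \<in> V \<and> a \<in> extensional V \<and> a \<rho> = 0 \<and>
     (\<forall>v w. is_child E \<rho> v w \<longrightarrow> a w - a v \<in> S) \<and> restrict (in_type S E \<rho> a) V \<in> labellings"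
proof -
  have "{v \<in> V. restrict (in_type S E \<rho> a) V v = (i, c)} = {v \<in> V. in_type S E \<rho> a v = (i, c)}" for i c
    by auto
  thus ?thesis
    unfolding trees_def embedded_cayley_trees_def labelling_iff V_def[symmetric] by (auto simp: PiE_iff)
qed

lemma parent_structures_iff:
  "(t, f) \<in> parent_structures \<longleftrightarrow> t \<in> labellings \<and> f \<in> V \<rightarrow>\<^sub>E insert 0 V \<and> acyclic (fgraph f V) \<and>
     (\<forall>i\<in>{l..r}. \<forall>u\<in>insert 0 V. card {v \<in> level V (fst \<circ> t) i. f v = u} = demand t i u)"
proof (cases "t \<in> labellings")
  case True
  have "{v \<in> V. (fst \<circ> t) v \<in> {l..r}} = V" using levels[OF True] by auto
  thus ?thesis unfolding parent_structures_def partial_trees_def by auto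
qed (simp add: parent_structures_def)

lemma parent_structures_card:
  assumes "(t, f) \<in> parent_structures" "u \<in> insert 0 V"
  shows "card {v \<in> level V (fst \<circ> t) i. f v = u} = (if i \<in> {l..r} then demand t i u else 0)"
proof (cases "i \<in> {l..r}")
  case True
  thus ?thesis using assms unfolding parent_structures_iff by auto
next
  case False
  hence "level V (fst \<circ> t) i = {}"
    using levels[of t] assms(1) unfolding parent_structures_iff level_def by auto
  thus ?thesis using False by auto
qed

context
  assumes zero: "0 \<in> {l..r}"
begin

text \<open>The virtual vertex has one child at level 0 and none elsewhere; level 0 is occupied by
  assumption.\<close>

lemma parent_structures_root:
  assumes "(t, f) \<in> parent_structures"
  obtains \<rho> where "\<rho> \<in> V" "fst (t \<rho>) = 0" "\<And>v. v \<in> V \<Longrightarrow> f v = 0 \<longleftrightarrow> v = \<rho>"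
    "(THE \<rho>. \<rho> \<in> V \<and> f \<rho> = 0) = \<rho>"
proof -
  have c: "card {v \<in> level V (fst \<circ> t) i. f v = 0} = of_bool (i = 0)" for i
    using parent_structures_card[OF assms, of 0 i] zero by (auto simp: demand_def)
  have "card {v \<in> level V (fst \<circ> t) 0. f v = 0} = 1" using c[of 0] by simp
  then obtain \<rho> where \<rho>: "{v \<in> level V (fst \<circ> t) 0. f v = 0} = {\<rho>}" by (rule card_1_singletonE)
  have root_level: "v \<in> {v \<in> level V (fst \<circ> t) 0. f v = 0}" if "v \<in> V" "f v = 0" for v
  proof (rule ccontr)
    assume "v \<notin> {v \<in> level V (fst \<circ> t) 0. f v = 0}"
    hence "fst (t v) \<noteq> 0" using that by (auto simp: level_def)
    hence "card {w \<in> level V (fst \<circ> t) (fst (t v)). f w = 0} = 0" using c by simp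
    thus False using that by (auto simp: level_def)
  qed
  have "f v = 0 \<longleftrightarrow> v = \<rho>" if "v \<in> V" for v
  proof -
    have "v \<in> {v \<in> level V (fst \<circ> t) 0. f v = 0} \<longleftrightarrow> v = \<rho>" unfolding \<rho> by simp
    thus ?thesis using root_level[OF that] by (metis (mono_tags, lifting) mem_Collect_eq)
  qed
  moreover have "\<rho> \<in> V" "fst (t \<rho>) = 0" using \<rho> by (auto simp: level_def)
  moreover from calculation have "(THE \<rho>. \<rho> \<in> V \<and> f \<rho> = 0) = \<rho>" by (intro the_equality) auto
  ultimately show ?thesis using that by blast
qed

text \<open>The fibre sizes of \<open>f\<close> are the child counts stored in \<open>t\<close>;
  beyond \<open>{l..r}\<close> both vanish. That in-types and children give back \<open>t\<close>
  and \<open>f\<close> is what injectivity rests on.\<close>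

lemma tree_of_props:
  assumes s: "(t, f) \<in> parent_structures" and eq: "tree_of (t, f) = (E, \<rho>, a)"
  shows "(E, \<rho>, a) \<in> trees" "\<And>v. v \<in> V \<Longrightarrow> in_type S E \<rho> a v = t v"
    "\<And>v w. is_child E \<rho> v w \<longleftrightarrow> w \<in> V \<and> f w = v \<and> v \<noteq> 0"
proof -
  obtain \<rho>' where \<rho>': "\<rho>' \<in> V" "fst (t \<rho>') = 0" "\<And>v. v \<in> V \<Longrightarrow> f v = 0 \<longleftrightarrow> v = \<rho>'"
    and "(THE \<rho>. \<rho> \<in> V \<and> f \<rho> = 0) = \<rho>'" by (rule parent_structures_root[OF s]) (rule that)
  hence E: "E = parent_edges V 0 f" and \<rho>: "\<rho> = \<rho>'" and a: "a = restrict (fst \<circ> t) V"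
    using eq by (auto simp: tree_of_def)
  have t: "t \<in> labellings" and f: "f \<in> V \<rightarrow>\<^sub>E insert 0 V" "acyclic (fgraph f V)"
    using s by (auto simp: parent_structures_iff)
  interpret parent_function V 0 \<rho> f
    by unfold_locales (use \<rho>' f in \<open>auto simp: \<rho>\<close>)
  show child: "is_child E \<rho> v w \<longleftrightarrow> w \<in> V \<and> f w = v \<and> v \<noteq> 0" for v w
    unfolding E by (rule is_child_iff)
  show it: "in_type S E \<rho> a v = t v" if v: "v \<in> V" for v
  proof -
    have "v \<noteq> 0" using v V_simps(3) by metis
    have "card {w. is_child E \<rho> v w \<and> a w = a v + k} = snd (t v) k" if k: "k \<in> S" for k
    proof -
      have "{w. is_child E \<rho> v w \<and> a w = a v + k} = {w \<in> level V (fst \<circ> t) (fst (t v) + k). f w = v}"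
        using v \<open>v \<noteq> 0\<close> by (auto simp: child a level_def simp del: neq0_conv)
      also have "card \<dots> = (if fst (t v) + k \<in> {l..r} then demand t (fst (t v) + k) v else 0)"
        using v by (intro parent_structures_card[OF s]) auto
      also have "\<dots> = snd (t v) k"
        using outside_zero[OF t v k] k by (auto simp: demand_V[OF v])
      finally show ?thesis .
    qed
    moreover have "snd (t v) \<in> S \<rightarrow>\<^sub>E UNIV" using n_ext t_type[OF t v] .
    ultimately have "(\<lambda>k\<in>S. card {w. is_child E \<rho> v w \<and> a w = a v + k}) = snd (t v)"
      by (auto simp: PiE_iff extensional_def fun_eq_iff)
    thus ?thesis using v by (simp add: in_type_def a)
  qed
  have "restrict (in_type S E \<rho> a) V = t"
    using it t by (auto simp: labelling_iff extensional_def fun_eq_iff)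
  \<comment> \<open>An actual child makes a fibre nonempty, so the demand is nonzero, which happens
    only for steps in \<open>S\<close>.\<close>
  moreover have "a w - a v \<in> S" if "is_child E \<rho> v w" for v w
  proof -
    have w: "w \<in> V" "f w = v" "v \<noteq> 0" using that child by auto
    hence v: "v \<in> V" using f by auto
    have "w \<in> {w' \<in> level V (fst \<circ> t) (fst (t w)). f w' = v}" using w by (auto simp: level_def)
    moreover have "finite {w' \<in> level V (fst \<circ> t) (fst (t w)). f w' = v}" by (auto simp: level_def)
    ultimately have "card {w' \<in> level V (fst \<circ> t) (fst (t w)). f w' = v} \<noteq> 0" by auto
    hence "demand t (fst (t w)) v \<noteq> 0" using parent_structures_card[OF s] v by (auto split: if_splits)
    thus ?thesis using v w by (auto simp: demand_V a split: if_splits)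
  qed
  ultimately show "(E, \<rho>, a) \<in> trees"
    using is_tree_parent_edges \<rho>'(1,2) t unfolding trees_iff by (auto simp: E \<rho> a)
qed

lemma bij_tree_of: "bij_betw tree_of parent_structures trees"
proof (rule bij_betw_imageI)
  show "inj_on tree_of parent_structures"
  proof (rule inj_onI, clarify)
    fix t f t' f'
    assume s: "(t, f) \<in> parent_structures" and s': "(t', f') \<in> parent_structures"
      and eq: "tree_of (t, f) = tree_of (t', f')"
    obtain E \<rho> a where e: "tree_of (t, f) = (E, \<rho>, a)" by (cases "tree_of (t, f)")
    note p = tree_of_props[OF s e] and p' = tree_of_props[OF s' e[unfolded eq]]
    have "t v = t' v" for v
      using p(2)[of v] p'(2)[of v] s s' unfolding parent_structures_iff labelling_iff extensional_def by force
    moreover have "f w = f' w" for w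
    \<comment> \<open>The tree determines every nonzero parent; where neither function has one, both
      take the value 0.\<close>
    proof (cases "w \<in> V")
      case True
      thus ?thesis using p(3)[of "f w" w] p'(3)[of "f w" w] p(3)[of "f' w" w] p'(3)[of "f' w" w] by metis
    next
      case False
      thus ?thesis using s s' unfolding parent_structures_iff by (auto simp: PiE_iff extensional_def)
    qed
    ultimately show "t = t' \<and> f = f'" by auto
  qed
  have "T \<in> tree_of ` parent_structures" if "T \<in> trees" for T
  proof -
    obtain E \<rho> a where T: "T = (E, \<rho>, a)" by (cases T)
    hence tr: "is_tree V E" "\<rho> \<in> V" "a \<in> extensional V" "a \<rho> = 0"
      "\<And>v w. is_child E \<rho> v w \<Longrightarrow> a w - a v \<in> S" "restrict (in_type S E \<rho> a) V \<in> labellings"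
      using that unfolding T trees_iff by auto
    define t where "t = restrict (in_type S E \<rho> a) V"
    obtain f where fV: "f \<in> V \<rightarrow>\<^sub>E insert 0 V" "parent_function V 0 \<rho> f" and E: "E = parent_edges V 0 f"
      using tree_obtain_parent_function[OF tr(1,2)] by (metis V_simps(1,3))
    interpret parent_function V 0 \<rho> f by (rule fV(2))
    have child: "is_child E \<rho> v w \<longleftrightarrow> w \<in> V \<and> f w = v \<and> v \<noteq> 0" for v w
      unfolding E by (rule is_child_iff)
    have ta: "fst (t v) = a v" if "v \<in> V" for v using that by (simp add: t_def in_type_def)
    have tc: "snd (t v) k = card {w. is_child E \<rho> v w \<and> a w = a v + k}" if "v \<in> V" "k \<in> S" for v k
      using that by (simp add: t_def in_type_def)
    \<comment> \<open>For steps in \<open>S\<close> this is the in-type of \<open>u\<close>; for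
      other steps the tree has no such child and the demand is 0.\<close>
    have fibres: "card {v \<in> level V (fst \<circ> t) i. f v = u} = demand t i u" if "u \<in> insert 0 V" for i u
    proof (cases "u = 0")
      case True
      have "{v \<in> level V (fst \<circ> t) i. f v = u} = (if i = 0 then {\<rho>} else {})"
        using True root tr(4) ta by (auto simp: level_def simp del: neq0_conv)
      thus ?thesis using True by (simp add: demand_def)
    next
      case False
      hence u: "u \<in> V" using that by auto
      have eq: "{v \<in> level V (fst \<circ> t) i. f v = u} = {w. is_child E \<rho> u w \<and> a w = a u + (i - a u)}"
        using False ta by (auto simp: level_def child)
      show ?thesis
      proof (cases "i - a u \<in> S")
        case True
        thus ?thesis unfolding eq demand_V[OF u] ta[OF u] using tc[OF u True] by simp
      next
        case no: False
        hence "{w. is_child E \<rho> u w \<and> a w = a u + (i - a u)} = {}" using tr(5) by fastforce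
        thus ?thesis unfolding eq demand_V[OF u] ta[OF u] by (simp only: no card.empty if_False)
      qed
    qed
    have "(t, f) \<in> parent_structures"
      unfolding parent_structures_iff
      by (intro conjI ballI fibres fV(1) acyc tr(6)[folded t_def])
    moreover have "tree_of (t, f) = T"
    proof -
      have "(THE \<rho>. \<rho> \<in> V \<and> f \<rho> = 0) = \<rho>" using root by (intro the_equality) auto
      moreover have "restrict (fst \<circ> t) V = a" using ta tr(3) by (auto simp: extensional_def fun_eq_iff)
      ultimately show ?thesis by (simp add: tree_of_def T E)
    qed
    ultimately show ?thesis by (metis image_eqI)
  qed
  thus "tree_of ` parent_structures = trees"
    using tree_of_props(1) by (auto, metis prod_cases3)
qed

text \<open>All labellings admit equally many parent functions, so the sum over them is a
  product.\<close>

lemma card_trees: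
  "card trees * ((\<Prod>(i, c)\<in>types. fact (n i c)) *
      (\<Prod>s\<in>S. \<Prod>b | children_count n s b > 0. fact b ^ children_count n s b)) =
   fact (total_count n) * ((\<Prod>i\<in>{l..r}. fact (level_count n i - 1)) *
     ((\<Prod>i\<in>{l..-1}. step_count n i (-1)) * (\<Prod>i\<in>{1..r}. step_count n i 1)))"
    (is "_ * (?n * ?c) = _ * ?R")
proof -
  let ?A = "\<lambda>t. partial_trees V 0 (fst \<circ> t) (demand t) {l..r}"
  have "card trees = card parent_structures" using bij_betw_same_card[OF bij_tree_of] ..
  also have "\<dots> = (\<Sum>t\<in>labellings. card (?A t))"
    unfolding parent_structures_def labellings_def
    by (rule card_SigmaI) (auto intro: finite_fibre_funs finite_types finite_partial_trees)
  finally have "card trees * ?c = (\<Sum>t\<in>labellings. card (?A t) * ?c)" by (simp only: sum_distrib_right)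
  also have "\<dots> = card labellings * ?R"
    using card_trees_of_labelling[OF _ zero] by simp
  finally have "card trees * ?c * ?n = card labellings * ?R * ?n" by (rule arg_cong)
  hence "card trees * (?n * ?c) = (card labellings * ?n) * ?R" by (simp only: mult_ac)
  thus ?thesis unfolding card_labellings .
qed

end

text \<open>The root has abscissa 0, which is thus an occupied level. Hence there are no trees when
  \<open>{l..r}\<close> misses 0.\<close>

lemma root_level: "trees \<noteq> {} \<Longrightarrow> 0 \<in> {l..r}"
proof -
  assume "trees \<noteq> {}"
  then obtain E \<rho> a where "(E, \<rho>, a) \<in> trees" by auto
  hence T: "\<rho> \<in> V" "a \<rho> = 0" "restrict (in_type S E \<rho> a) V \<in> labellings" unfolding trees_iff by auto
  have "(fst \<circ> restrict (in_type S E \<rho> a) V) \<rho> \<in> {l..r}" using levels[OF T(3)] T(1) by blast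
  thus ?thesis using T by (simp add: in_type_def)
qed

end

theorem theorem2p5:
  fixes m l r :: int and n :: "int \<Rightarrow> (int \<Rightarrow> nat) \<Rightarrow> nat"
  assumes "m \<le> 1"
    and "\<And>i c. n i c > 0 \<Longrightarrow> c \<in> {m..1} \<rightarrow>\<^sub>E UNIV"
    and "finite {(i, c). n i c > 0}"
    and "level_count n l > 0" and "\<And>i. level_count n i > 0 \<Longrightarrow> l \<le> i"
    and "level_count n r > 0" and "\<And>i. level_count n i > 0 \<Longrightarrow> i \<le> r"
    and "\<And>i. l \<le> i \<Longrightarrow> i \<le> r \<Longrightarrow> level_count n i > 0"
    and "\<And>i. l \<le> i \<Longrightarrow> i \<le> r \<Longrightarrow>
           of_bool (i = 0) + (\<Sum>s\<in>{m..1}. step_count n i s) = level_count n i"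
    and "\<And>i s. i < l \<or> r < i \<Longrightarrow> s \<in> {m..1} \<Longrightarrow> step_count n i s = 0"
    and "m = -1 \<or> (\<forall>i<0. \<forall>c. n i c = 0)"
  shows "real (card {(E, \<rho>, a) \<in> embedded_cayley_trees {m..1} (total_count n).
                 \<forall>i c. card {v \<in> {1..total_count n}. in_type {m..1} E \<rho> a v = (i, c)} = n i c}) =
         fact (total_count n) * (\<Prod>i\<in>{l..r}. fact (level_count n i - 1)) /
           ((\<Prod>(i, c) | n i c > 0. fact (n i c)) *
            (\<Prod>s\<in>{m..1}. \<Prod>b | children_count n s b > 0. fact b ^ children_count n s b)) *
         (\<Prod>i\<in>{l..-1}. real (step_count n i (-1))) *
         (\<Prod>i\<in>{1..r}. real (step_count n i 1))"
proof -
  interpret profile m l r n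
  proof
    show "level_count n i > 0 \<longleftrightarrow> i \<in> {l..r}" for i
      using assms(5)[of i] assms(7)[of i] assms(8)[of i] by (metis atLeastAtMost_iff)
    show "step_count n i s = 0" if "i \<notin> {l..r}" "s \<in> {m..1}" for i s
      using assms(10)[of i s] that by auto
  qed (use assms(1-3,9,11) in auto)
  have "l \<le> r" using assms(4,7) by auto
  show ?thesis
    unfolding trees_def[symmetric] types_def[symmetric]
  proof (cases "0 \<in> {l..r}")
    case True
    let ?n = "\<Prod>(i, c)\<in>types. fact (n i c)"
    let ?c = "\<Prod>s\<in>{m..1}. \<Prod>b | children_count n s b > 0. fact b ^ children_count n s b"
    have "real (card trees * (?n * ?c)) =
       real (fact (total_count n) * ((\<Prod>i\<in>{l..r}. fact (level_count n i - 1)) *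
       ((\<Prod>i\<in>{l..-1}. step_count n i (-1)) * (\<Prod>i\<in>{1..r}. step_count n i 1))))"
      unfolding card_trees[OF True] ..
    hence "real (card trees) * (?n * ?c) = fact (total_count n) * (\<Prod>i\<in>{l..r}. fact (level_count n i - 1)) *
         (\<Prod>i\<in>{l..-1}. real (step_count n i (-1))) * (\<Prod>i\<in>{1..r}. real (step_count n i 1))"
      by (simp add: case_prod_unfold of_nat_prod mult.assoc)
    \<comment> \<open>Being nonzero, the factorials can be moved to the denominator.\<close>
    moreover have "?n * ?c \<noteq> (0 :: real)"
    proof -
      have "?n \<noteq> (0 :: real)" using finite_types by (simp add: case_prod_unfold)
      moreover have "?c \<noteq> (0 :: real)" by (intro less_imp_neq[THEN not_sym] prod_pos) simp
      ultimately show ?thesis by (rule no_zero_divisors)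
    qed
    ultimately show "real (card trees) = fact (total_count n) * (\<Prod>i\<in>{l..r}. fact (level_count n i - 1)) /
           (?n * ?c) * (\<Prod>i\<in>{l..-1}. real (step_count n i (-1))) * (\<Prod>i\<in>{1..r}. real (step_count n i 1))"
      by (simp add: nonzero_eq_divide_eq)
  next
    case False
    hence "trees = {}" using root_level by blast
    have "level_count n 0 = 0" using level_pos[of 0] False by auto
    hence n0: "n 0 c = 0" for c using finite_types_at[of 0] by (auto simp: level_count_def)
    \<comment> \<open>Such children would have their parents at level 0, which is empty.\<close>
    hence s0: "step_count n i i = 0" for i by (simp add: step_count_def)
    \<comment> \<open>All levels lie on one side of 0. The formula then contains the factor for
      level 1 or for level -1, which is 0, in accordance with the absence of trees.\<close>
    have "l > 0 \<or> r < 0" using False by auto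
    hence "(\<Prod>i\<in>{l..-1}. real (step_count n i (-1))) = 0 \<or> (\<Prod>i\<in>{1..r}. real (step_count n i 1)) = 0"
    proof
      assume "l > 0"
      hence "1 \<in> {1..r}" using \<open>l \<le> r\<close> by auto
      thus ?thesis using s0[of 1] by (intro disjI2) (auto simp: prod_zero_iff)
    next
      assume "r < 0"
      hence "-1 \<in> {l..-1}" using \<open>l \<le> r\<close> by auto
      thus ?thesis using s0[of "-1"] by (intro disjI1) (auto simp: prod_zero_iff)
    qed
    thus "real (card trees) = fact (total_count n) * (\<Prod>i\<in>{l..r}. fact (level_count n i - 1)) /
           ((\<Prod>(i, c)\<in>types. fact (n i c)) * (\<Prod>s\<in>{m..1}. \<Prod>b | children_count n s b > 0. fact b ^ children_count n s b)) *
           (\<Prod>i\<in>{l..-1}. real (step_count n i (-1))) * (\<Prod>i\<in>{1..r}. real (step_count n i 1))"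
      using \<open>trees = {}\<close> by auto
  qed
qed

end
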